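(* Let $R$ be a commutative ring with nonzero identity and let $M$ be a unital $R$-module. If $AG(M)$ is a tree, then either $AG(M)$ is a star graph or $AG(M)\cong P_4$. Moreover, $AG(M)\cong P_4$ if and only if $M=F\times S$, where $F$ is a simple module and $S$ is a module with a unique non-trivial submodule.
   Context: For a submodule $N\leq M$, $(N:M)=\{r\in R : rM\subseteq N\}$ and $Ann(M)=((0):M)$. The product of submodules $N,K\leq M$ is $NK:=(N:M)(K:M)M$. The annihilating-submodule graph $AG(M)$ is the undirected graph whose vertices are the nonzero submodules $N$ of $M$ (possibly $N=M$) for which there exists a nonzero proper submodule $K$ of $M$ with $NK=(0)$; two distinct vertices $N,K$ are adjacent if and only if $NK=(0)$. A graph has, by convention, a nonempty vertex set, so saying that $AG(M)$ is a graph of some kind presupposes that it has at least one vertex. A star graph is a complete bipartite graph $K_{1,m}$, where $m$ may be any cardinal (a single vertex counts as $K_{1,0}$). $P_4$ is the path on $4$ vertices. A non-trivial submodule of a module is a nonzero proper submodule.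
   Formalization: The "Moreover" equivalence is stated under the hypothesis that AG(M) is a tree; without it, "M = F×S implies AG(M) ≅ P_4" fails, e.g. for M = Z/2 × Z/4 over Z, where AG(M) contains a triangle. *)

theory Defs
  imports "HOL-Algebra.Algebra"
begin

section \<open>Simple undirected graphs\<close>

text \<open>
  Vertex sets may be infinite. An edge is a two-element set of vertices; loops and multiple edges
  do not occur in any graph defined below.
\<close>

record 'v ugraph =
  vertices :: "'v set"
  edges :: "'v set set"

definition is_walk :: "'v ugraph \<Rightarrow> 'v list \<Rightarrow> bool" where
  "is_walk G p \<longleftrightarrow> p \<noteq> [] \<and> set p \<subseteq> vertices G \<and>
     (\<forall>i. Suc i < length p \<longrightarrow> {p ! i, p ! Suc i} \<in> edges G)"

definition is_connected :: "'v ugraph \<Rightarrow> bool" where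
  "is_connected G \<longleftrightarrow> vertices G \<noteq> {} \<and>
     (\<forall>u \<in> vertices G. \<forall>v \<in> vertices G. \<exists>p. is_walk G p \<and> hd p = u \<and> last p = v)"

text \<open>The closing edge, from the last vertex of the list back to the first, is implicit.\<close>

definition is_cycle :: "'v ugraph \<Rightarrow> 'v list \<Rightarrow> bool" where
  "is_cycle G p \<longleftrightarrow> is_walk G p \<and> distinct p \<and> 3 \<le> length p \<and> {last p, hd p} \<in> edges G"

definition is_tree :: "'v ugraph \<Rightarrow> bool" where
  "is_tree G \<longleftrightarrow> is_connected G \<and> (\<nexists>p. is_cycle G p)"

definition graph_iso :: "'v ugraph \<Rightarrow> 'w ugraph \<Rightarrow> bool" where
  "graph_iso G H \<longleftrightarrow> (\<exists>f. bij_betw f (vertices G) (vertices H) \<and>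
     (\<forall>u \<in> vertices G. \<forall>v \<in> vertices G. {u, v} \<in> edges G \<longleftrightarrow> {f u, f v} \<in> edges H))"

definition complete_bipartite :: "'v set \<Rightarrow> 'v set \<Rightarrow> 'v ugraph" where
  "complete_bipartite A B = \<lparr>vertices = A \<union> B, edges = {{a, b} | a b. a \<in> A \<and> b \<in> B}\<rparr>"

text \<open>The set \<open>B\<close> of leaves may be empty or infinite.\<close>

definition is_star :: "'v ugraph \<Rightarrow> bool" where
  "is_star G \<longleftrightarrow> (\<exists>c B. c \<notin> B \<and> G = complete_bipartite {c} B)"

text \<open>The index \<open>n\<close> is the number of vertices, not of edges.\<close>

definition path_graph :: "nat \<Rightarrow> nat ugraph" where
  "path_graph n = \<lparr>vertices = {..<n}, edges = {{i, Suc i} | i. Suc i < n}\<rparr>"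


section \<open>Modules\<close>

definition nontrivial_submodule ::
    "'b set \<Rightarrow> ('a, 'c) ring_scheme \<Rightarrow> ('a, 'b, 'd) module_scheme \<Rightarrow> bool" where
  "nontrivial_submodule N R M \<longleftrightarrow>
     submodule N R M \<and> N \<noteq> {\<zero>\<^bsub>M\<^esub>} \<and> N \<noteq> carrier M"

definition simple_module ::
    "('a, 'c) ring_scheme \<Rightarrow> ('a, 'b, 'd) module_scheme \<Rightarrow> bool" where
  "simple_module R M \<longleftrightarrow>
     module R M \<and> carrier M \<noteq> {\<zero>\<^bsub>M\<^esub>} \<and> (\<nexists>N. nontrivial_submodule N R M)"

definition module_iso ::
    "('a, 'c) ring_scheme \<Rightarrow> ('a, 'b, 'd) module_scheme \<Rightarrow> ('a, 'e, 'f) module_scheme \<Rightarrow> bool" where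
  "module_iso R M N \<longleftrightarrow> (\<exists>h. bij_betw h (carrier M) (carrier N) \<and>
     (\<forall>x \<in> carrier M. \<forall>y \<in> carrier M. h (x \<oplus>\<^bsub>M\<^esub> y) = h x \<oplus>\<^bsub>N\<^esub> h y) \<and>
     (\<forall>a \<in> carrier R. \<forall>x \<in> carrier M. h (a \<odot>\<^bsub>M\<^esub> x) = a \<odot>\<^bsub>N\<^esub> h x))"

text \<open>
  A module record inherits a multiplication and a one from the ring record; these fields play no
  role for modules. \<open>RDirProd\<close> supplies the carrier and the componentwise zero and addition.
\<close>

definition module_prod ::
    "('a, 'b, 'd) module_scheme \<Rightarrow> ('a, 'e, 'f) module_scheme \<Rightarrow> ('a, 'b \<times> 'e) module" where
  "module_prod M N = ring.extend (RDirProd M N)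
     \<lparr>smult = (\<lambda>a (x, y). (a \<odot>\<^bsub>M\<^esub> x, a \<odot>\<^bsub>N\<^esub> y))\<rparr>"


section \<open>Products of submodules and the annihilating-submodule graph\<close>

text \<open>The ideal \<open>(N : M)\<close>.\<close>

definition colon ::
    "('a, 'c) ring_scheme \<Rightarrow> ('a, 'b, 'd) module_scheme \<Rightarrow> 'b set \<Rightarrow> 'a set" where
  "colon R M N = {r \<in> carrier R. \<forall>m \<in> carrier M. r \<odot>\<^bsub>M\<^esub> m \<in> N}"

text \<open>
  For an ideal \<open>I\<close>, the submodule \<open>I M\<close>, i.e. the finite sums of elements \<open>i m\<close>; the same encoding
  as \<open>ideal_prod\<close>.
\<close>

inductive_set ideal_smult :: "('a, 'b, 'd) module_scheme \<Rightarrow> 'a set \<Rightarrow> 'b set"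
  for M and I where
    smult: "\<lbrakk>i \<in> I; m \<in> carrier M\<rbrakk> \<Longrightarrow> i \<odot>\<^bsub>M\<^esub> m \<in> ideal_smult M I"
  | sum: "\<lbrakk>x \<in> ideal_smult M I; y \<in> ideal_smult M I\<rbrakk> \<Longrightarrow> x \<oplus>\<^bsub>M\<^esub> y \<in> ideal_smult M I"

definition submodule_prod ::
    "('a, 'c) ring_scheme \<Rightarrow> ('a, 'b, 'd) module_scheme \<Rightarrow> 'b set \<Rightarrow> 'b set \<Rightarrow> 'b set" where
  "submodule_prod R M N K = ideal_smult M (ideal_prod R (colon R M N) (colon R M K))"

definition AG_vertices ::
    "('a, 'c) ring_scheme \<Rightarrow> ('a, 'b, 'd) module_scheme \<Rightarrow> 'b set set" where
  "AG_vertices R M = {N. submodule N R M \<and> N \<noteq> {\<zero>\<^bsub>M\<^esub>} \<and>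
     (\<exists>K. nontrivial_submodule K R M \<and> submodule_prod R M N K = {\<zero>\<^bsub>M\<^esub>})}"

definition AG ::
    "('a, 'c) ring_scheme \<Rightarrow> ('a, 'b, 'd) module_scheme \<Rightarrow> 'b set ugraph" where
  "AG R M = \<lparr>vertices = AG_vertices R M,
     edges = {{N, K} | N K. N \<in> AG_vertices R M \<and> K \<in> AG_vertices R M \<and> N \<noteq> K \<and>
       submodule_prod R M N K = {\<zero>\<^bsub>M\<^esub>}}\<rparr>"

end

theory Submission
  imports Defs
begin

text \<open>
Write \<open>I\<^sub>N\<close> for \<open>(N : M)\<close>. Then \<open>NK = 0\<close> says that \<open>i (j m) = 0\<close> for all \<open>i \<in> I\<^sub>N\<close>, \<open>j \<in> I\<^sub>K\<close>
and \<open>m \<in> M\<close>. So the product is monotone, and distinct nonzero proper submodules that meet in \<open>0\<close> are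
adjacent. Both properties force many adjacencies, and acyclicity excludes the triangles and squares
that would arise from them.

A tree is a star unless it contains a path \<open>a - b - c - d\<close> on four distinct vertices
(\<open>tree_star_or_four_path\<close>). Suppose that \<open>AG(M)\<close> contains one. No nonzero proper submodule \<open>K\<close> can
satisfy \<open>I\<^sub>K M = 0\<close>: it would be adjacent to every other vertex and so close a triangle on one of the
disjoint edges \<open>ab\<close>, \<open>cd\<close>. Consequently \<open>M\<close> itself is not a vertex. If \<open>b \<inter> c\<close>, or a nonzero proper
submodule of \<open>b\<close> or of \<open>c\<close>, existed as a new vertex, it would inherit the neighbours of what contains
it and close a cycle. Hence \<open>b\<close> and \<open>c\<close> are minimal submodules that meet in \<open>0\<close>. They cannot both
have square zero, since otherwise \<open>b\<close>, \<open>c\<close> and \<open>b + c\<close> form a triangle; by symmetry let \<open>bb \<noteq> 0\<close>.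
Then some \<open>x \<in> I\<^sub>b\<close> acts bijectively on the minimal submodule \<open>b\<close>, and as in Brauer's lemma
\<open>M = b \<oplus> K\<close> with \<open>K\<close> the kernel of \<open>x\<close>. The submodule \<open>c\<close> turns out to be the only nontrivial
submodule of \<open>K\<close> (\<open>splitting_if_inner_square_nonzero\<close>), which gives the decomposition \<open>F \<times> S\<close>.

Conversely let \<open>M = b \<oplus> K\<close> with \<open>b\<close> minimal and \<open>c\<close> the only nontrivial submodule of \<open>K\<close>. Then
\<open>K - b - c - (b + c)\<close> is always a path in \<open>AG(M)\<close>. The tree hypothesis is what makes it the whole
graph. For \<open>F = \<int>/p\<close> and \<open>S = \<int>/p\<^sup>2\<close> over the integers it is not, and there \<open>c\<close>, \<open>b + c\<close>, \<open>K\<close>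
form a triangle. In general that triangle appears as soon as every scalar that kills \<open>K\<close> also kills
\<open>b\<close> (\<open>splitting_separating_scalar\<close>). Otherwise some scalar acts as the projection of \<open>M\<close> onto \<open>b\<close>, so
each submodule is the sum of its intersections with \<open>b\<close> and \<open>K\<close>, and the nontrivial ones are exactly
the four vertices of the path. All of this takes place inside \<open>M\<close>; the predicate \<open>splitting\<close> records
the internal decomposition, and the last part translates it to and from an isomorphism with an
external product.
\<close>

section \<open>Trees and paths on four vertices\<close>

lemma tree_no_triangle:
  assumes "is_tree G" "{a, b, c} \<subseteq> vertices G" "distinct [a, b, c]"
    "{a, b} \<in> edges G" "{b, c} \<in> edges G" "{c, a} \<in> edges G"
  shows False
proof -
  have "is_cycle G [a, b, c]"
    using assms by (auto simp: is_cycle_def is_walk_def less_Suc_eq)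
  then show False using assms(1) by (auto simp: is_tree_def)
qed

lemma tree_no_square:
  assumes "is_tree G" "{a, b, c, d} \<subseteq> vertices G" "distinct [a, b, c, d]"
    "{a, b} \<in> edges G" "{b, c} \<in> edges G" "{c, d} \<in> edges G" "{d, a} \<in> edges G"
  shows False
proof -
  have "is_cycle G [a, b, c, d]"
    using assms by (auto simp: is_cycle_def is_walk_def less_Suc_eq)
  then show False using assms(1) by (auto simp: is_tree_def)
qed

text \<open>
In a connected graph a nonempty set that is closed under adjacency therefore contains all vertices.
\<close>

lemma walk_in_closed_set:
  assumes "is_walk G p" "hd p \<in> A"
    and closed: "\<And>u v. u \<in> A \<Longrightarrow> {u, v} \<in> edges G \<Longrightarrow> v \<in> A"
  shows "last p \<in> A"
proof -
  have "i < length p \<Longrightarrow> p ! i \<in> A" for i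
  proof (induction i)
    case 0
    then show ?case using assms(2) by (simp add: hd_conv_nth)
  next
    case (Suc i)
    then show ?case using assms(1) closed unfolding is_walk_def by (metis Suc_lessD)
  qed
  then show ?thesis using assms(1) by (simp add: is_walk_def last_conv_nth)
qed

definition has_four_path :: "'v ugraph \<Rightarrow> bool" where
  "has_four_path G \<longleftrightarrow> (\<exists>a b c d. distinct [a, b, c, d] \<and>
     {a, b} \<in> edges G \<and> {b, c} \<in> edges G \<and> {c, d} \<in> edges G)"

text \<open>
The graph record admits arbitrary sets as edges; this excludes all but pairs of distinct vertices.
\<close>

definition simple_edges :: "'v ugraph \<Rightarrow> bool" where
  "simple_edges G \<longleftrightarrow> (\<forall>e \<in> edges G. \<exists>u v. u \<noteq> v \<and> u \<in> vertices G \<and> v \<in> vertices G \<and> e = {u, v})"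

lemma simple_edgesD:
  assumes "simple_edges G" "{u, v} \<in> edges G"
  shows "u \<noteq> v" "u \<in> vertices G" "v \<in> vertices G"
  using assms unfolding simple_edges_def by (metis doubleton_eq_iff)+

text \<open>
Take as centre a vertex \<open>s\<close> with at least two neighbours, if there is one. If a neighbour \<open>t\<close> of \<open>s\<close>
has a further neighbour \<open>y\<close> and \<open>w\<close> is another neighbour of \<open>s\<close>, then \<open>y - t - s - w\<close> is a path on
four vertices, or a triangle if \<open>y = w\<close>. So the neighbours of \<open>s\<close> have \<open>s\<close> as their only neighbour.
\<close>

lemma tree_star_or_four_path:
  assumes tree: "is_tree G" and simp: "simple_edges G"
  shows "is_star G \<or> has_four_path G"
proof (rule disjCI)
  assume no_path: "\<not> has_four_path G"
  define forks where "forks x \<longleftrightarrow> (\<exists>u w. {x, u} \<in> edges G \<and> {x, w} \<in> edges G \<and> u \<noteq> w)" for x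
  obtain v where v: "v \<in> vertices G"
    using tree by (auto simp: is_tree_def is_connected_def)
  have forks_vertex: "x \<in> vertices G" if "forks x" for x
    using that simple_edgesD(2)[OF simp] by (auto simp: forks_def)
  obtain s where s: "s \<in> vertices G" and branch: "\<And>x. forks x \<Longrightarrow> forks s"
  proof (cases "\<exists>x. forks x")
    case True
    then obtain x where "forks x" by blast
    then show ?thesis using that[of x] forks_vertex by simp
  next
    case False
    then show ?thesis using that[of v] v by simp
  qed
  define A where "A = {t. {s, t} \<in> edges G}"
  have second: "y = s" if t: "t \<in> A" and y: "{t, y} \<in> edges G" for t y
  proof (rule ccontr)
    assume "y \<noteq> s"
    moreover have st: "{s, t} \<in> edges G" using t by (simp add: A_def)
    \<comment> \<open>If \<open>t\<close> has a neighbour besides \<open>s\<close>, then it has two neighbours, and so has \<open>s\<close> by its choice.\<close>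
    ultimately have "forks t" using y unfolding forks_def by (metis insert_commute)
    then have "forks s" by (rule branch)
    then obtain w where w: "{s, w} \<in> edges G" "w \<noteq> t" unfolding forks_def by metis
    have ne: "s \<noteq> t" "s \<noteq> w" "t \<noteq> y" using simple_edgesD[OF simp] st w y by metis+
    show False
    proof (cases "y = w")
      case True
      then show False
        using tree_no_triangle[OF tree, of s t w] st w y ne simple_edgesD[OF simp]
        by (auto simp: insert_commute)
    next
      case False
      then have "distinct [y, t, s, w]" using ne w \<open>y \<noteq> s\<close> by auto
      moreover have "{y, t} \<in> edges G" "{t, s} \<in> edges G"
        using st y by (simp_all add: insert_commute)
      ultimately have "has_four_path G"
        unfolding has_four_path_def using w(1) by blast
      then show False using no_path by simp
    qed
  qed
  have closed: "v \<in> insert s A" if "u \<in> insert s A" "{u, v} \<in> edges G" for u v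
  proof (cases "u = s")
    case True
    then show ?thesis using that(2) by (simp add: A_def)
  next
    case False
    then have "u \<in> A" using that(1) by simp
    then have "v = s" using that(2) by (rule second)
    then show ?thesis by simp
  qed
  have verts: "vertices G = insert s A"
  proof
    show "vertices G \<subseteq> insert s A"
    proof
      fix v assume "v \<in> vertices G"
      then obtain p where "is_walk G p" "hd p = s" "last p = v"
        using tree s unfolding is_tree_def is_connected_def by blast
      then show "v \<in> insert s A"
        using walk_in_closed_set[of G p "insert s A"] closed by blast
    qed
    show "insert s A \<subseteq> vertices G" using s simple_edgesD(3)[OF simp] by (auto simp: A_def)
  qed
  have "edges G = {{s, t} | t. t \<in> A}"
  proof
    show "edges G \<subseteq> {{s, t} | t. t \<in> A}"
    proof
      fix e assume e: "e \<in> edges G"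
      then obtain u v where uv: "e = {u, v}" "u \<in> insert s A"
        using simp verts unfolding simple_edges_def by metis
      then have "u = s \<or> v = s" using second[of u v] e by blast
      then have "e = {s, v} \<or> e = {s, u}" using uv by auto
      then show "e \<in> {{s, t} | t. t \<in> A}" using e by (auto simp: A_def)
    qed
  qed (auto simp: A_def)
  then have "G = complete_bipartite {s} A"
    using verts by (cases G) (auto simp: complete_bipartite_def)
  moreover have "s \<notin> A" using simple_edgesD(1)[OF simp, of s s] by (auto simp: A_def)
  ultimately show "is_star G" unfolding is_star_def by blast
qed

lemma four_path_if_iso:
  assumes "graph_iso G (path_graph 4)"
  shows "has_four_path G"
proof -
  obtain f where f: "bij_betw f (vertices G) {..<4::nat}"
    and e: "\<And>u v. u \<in> vertices G \<Longrightarrow> v \<in> vertices G \<Longrightarrow>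
      {u, v} \<in> edges G \<longleftrightarrow> {f u, f v} \<in> edges (path_graph 4)"
    using assms unfolding graph_iso_def path_graph_def by auto
  have "\<exists>x. \<forall>i<4. x i \<in> vertices G \<and> f (x i) = i"
    using f unfolding bij_betw_def by (intro choice) (metis imageE lessThan_iff)
  then obtain x where x: "\<And>i. i < 4 \<Longrightarrow> x i \<in> vertices G \<and> f (x i) = i" by blast
  have edge: "{x i, x (Suc i)} \<in> edges G" if "Suc i < 4" for i
    using e[of "x i" "x (Suc i)"] x[of i] x[of "Suc i"] that by (auto simp: path_graph_def)
  have ne: "x i \<noteq> x j" if "i < 4" "j < 4" "i \<noteq> j" for i j
    using x that by metis
  have "distinct [x 0, x 1, x 2, x 3]" by (simp add: ne)
  moreover have "{x 0, x 1} \<in> edges G" "{x 1, x 2} \<in> edges G" "{x 2, x 3} \<in> edges G"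
    using edge[of 0] edge[of 1] edge[of 2] by (simp_all add: eval_nat_numeral)
  ultimately show ?thesis unfolding has_four_path_def by blast
qed

text \<open>
Acyclicity forbids every chord of the path, so the four given vertices and three edges determine
the graph.
\<close>

lemma iso_path_if_spanning_four_path:
  assumes tree: "is_tree G" and simp: "simple_edges G"
    and V: "vertices G = {a, b, c, d}" and dist: "distinct [a, b, c, d]"
    and E: "{a, b} \<in> edges G" "{b, c} \<in> edges G" "{c, d} \<in> edges G"
  shows "graph_iso G (path_graph 4)"
proof -
  define f where "f = (\<lambda>v. if v = a then 0 else if v = b then 1 else if v = c then 2 else (3::nat))"
  have fv: "f a = 0" "f b = 1" "f c = 2" "f d = 3" using dist by (auto simp: f_def)
  have bij: "bij_betw f (vertices G) {..<4}"
    unfolding bij_betw_def inj_on_def V using fv by (auto simp: lessThan_nat_numeral lessThan_Suc)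
  have "{a, c} \<notin> edges G" "{b, d} \<notin> edges G"
    using tree_no_triangle[OF tree, of a b c] tree_no_triangle[OF tree, of b c d] dist E V
    by (auto simp: insert_commute)
  moreover have "{a, d} \<notin> edges G"
    using tree_no_square[OF tree, of a b c d] dist E V by (auto simp: insert_commute)
  moreover have "{v, v} \<notin> edges G" for v using simple_edgesD(1)[OF simp] by blast
  moreover have "{i, j} \<in> edges (path_graph 4) \<longleftrightarrow> (i < 4 \<and> j < 4 \<and> (j = Suc i \<or> i = Suc j))" for i j :: nat
    by (auto simp: path_graph_def doubleton_eq_iff)
  ultimately have "\<forall>u \<in> vertices G. \<forall>v \<in> vertices G.
      {u, v} \<in> edges G \<longleftrightarrow> {f u, f v} \<in> edges (path_graph 4)"
    using E unfolding V by (auto simp: fv insert_commute)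
  then show ?thesis using bij unfolding graph_iso_def by (auto simp: path_graph_def)
qed

section \<open>Submodules and vanishing products\<close>

context module
begin

abbreviation nontrivial :: "'c set \<Rightarrow> bool" where
  "nontrivial N \<equiv> nontrivial_submodule N R M"

lemma zero_in_submodule: "submodule N R M \<Longrightarrow> \<zero>\<^bsub>M\<^esub> \<in> N"
  using subgroup.one_closed[of N "add_monoid M"] by (simp add: submodule_def)

lemma submodule_mem_carrier: "submodule N R M \<Longrightarrow> x \<in> N \<Longrightarrow> x \<in> carrier M"
  using submoduleE(1) by blast

lemma submodule_minus_closed:
  "submodule N R M \<Longrightarrow> x \<in> N \<Longrightarrow> y \<in> N \<Longrightarrow> x \<ominus>\<^bsub>M\<^esub> y \<in> N"
  by (simp add: M.minus_eq submoduleE(3,5))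

lemma zero_submodule: "submodule {\<zero>\<^bsub>M\<^esub>} R M"
  by (intro submoduleI) auto

lemma submodule_Int:
  assumes "submodule N R M" "submodule K R M"
  shows "submodule (N \<inter> K) R M"
  using submoduleE[OF assms(1)] submoduleE[OF assms(2)] zero_in_submodule assms
  by (intro submoduleI) auto

lemma set_add_iff:
  "x \<in> N <+>\<^bsub>M\<^esub> K \<longleftrightarrow> (\<exists>n \<in> N. \<exists>k \<in> K. x = n \<oplus>\<^bsub>M\<^esub> k)"
  by (auto simp: set_add_def')

lemma submodule_set_add:
  assumes N: "submodule N R M" and K: "submodule K R M"
  shows "submodule (N <+>\<^bsub>M\<^esub> K) R M"
proof (intro submoduleI)
  note mem = submodule_mem_carrier[OF N] submodule_mem_carrier[OF K]
  show "N <+>\<^bsub>M\<^esub> K \<subseteq> carrier M" using mem by (auto simp: set_add_iff)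
  show "\<zero>\<^bsub>M\<^esub> \<in> N <+>\<^bsub>M\<^esub> K"
    unfolding set_add_iff using zero_in_submodule N K by force
  show "\<ominus>\<^bsub>M\<^esub> x \<in> N <+>\<^bsub>M\<^esub> K" if "x \<in> N <+>\<^bsub>M\<^esub> K" for x
    using that mem submoduleE(3)[OF N] submoduleE(3)[OF K]
    unfolding set_add_iff by (metis M.minus_add)
  show "x \<oplus>\<^bsub>M\<^esub> y \<in> N <+>\<^bsub>M\<^esub> K" if xy: "x \<in> N <+>\<^bsub>M\<^esub> K" "y \<in> N <+>\<^bsub>M\<^esub> K" for x y
  proof -
    obtain n k n' k' where *: "n \<in> N" "k \<in> K" "x = n \<oplus>\<^bsub>M\<^esub> k" "n' \<in> N" "k' \<in> K" "y = n' \<oplus>\<^bsub>M\<^esub> k'"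
      using xy unfolding set_add_iff by blast
    then have "x \<oplus>\<^bsub>M\<^esub> y = (n \<oplus>\<^bsub>M\<^esub> n') \<oplus>\<^bsub>M\<^esub> (k \<oplus>\<^bsub>M\<^esub> k')"
      using mem by (simp add: M.a_ac)
    then show ?thesis using * submoduleE(5)[OF N] submoduleE(5)[OF K] unfolding set_add_iff by blast
  qed
  show "a \<odot>\<^bsub>M\<^esub> x \<in> N <+>\<^bsub>M\<^esub> K" if "a \<in> carrier R" "x \<in> N <+>\<^bsub>M\<^esub> K" for a x
    using that mem submoduleE(4)[OF N] submoduleE(4)[OF K]
    unfolding set_add_iff by (metis smult_r_distr)
qed

lemma subset_set_add:
  assumes N: "submodule N R M" and K: "submodule K R M"
  shows "N \<subseteq> N <+>\<^bsub>M\<^esub> K" "K \<subseteq> N <+>\<^bsub>M\<^esub> K"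
proof -
  have "x \<in> N <+>\<^bsub>M\<^esub> K" if "x \<in> N" for x
    using that zero_in_submodule[OF K] submodule_mem_carrier[OF N] unfolding set_add_iff
    by (metis M.r_zero)
  moreover have "x \<in> N <+>\<^bsub>M\<^esub> K" if "x \<in> K" for x
    using that zero_in_submodule[OF N] submodule_mem_carrier[OF K] unfolding set_add_iff
    by (metis M.l_zero)
  ultimately show "N \<subseteq> N <+>\<^bsub>M\<^esub> K" "K \<subseteq> N <+>\<^bsub>M\<^esub> K" by auto
qed

lemma smult_commute:
  assumes "a \<in> carrier R" "b \<in> carrier R" "x \<in> carrier M"
  shows "a \<odot>\<^bsub>M\<^esub> (b \<odot>\<^bsub>M\<^esub> x) = b \<odot>\<^bsub>M\<^esub> (a \<odot>\<^bsub>M\<^esub> x)"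
  using assms by (metis R.m_comm smult_assoc1)

lemma smult_diff_one:
  assumes "r \<in> carrier R" "x \<in> carrier M"
  shows "(\<one> \<ominus> r) \<odot>\<^bsub>M\<^esub> x = x \<ominus>\<^bsub>M\<^esub> r \<odot>\<^bsub>M\<^esub> x"
  using assms by (simp add: R.minus_eq M.minus_eq smult_l_distr smult_l_minus)

lemma smult_minus_distr:
  assumes "r \<in> carrier R" "x \<in> carrier M" "y \<in> carrier M"
  shows "r \<odot>\<^bsub>M\<^esub> (x \<ominus>\<^bsub>M\<^esub> y) = r \<odot>\<^bsub>M\<^esub> x \<ominus>\<^bsub>M\<^esub> r \<odot>\<^bsub>M\<^esub> y"
  using assms by (simp add: M.minus_eq smult_r_distr smult_r_minus)

lemma add_minus_cancel:
  assumes "x \<in> carrier M" "y \<in> carrier M"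
  shows "y \<oplus>\<^bsub>M\<^esub> (x \<ominus>\<^bsub>M\<^esub> y) = x"
  using assms by (simp add: M.minus_eq M.a_lcomm[of y x] M.r_neg)

lemma submodule_smult_image:
  assumes r: "r \<in> carrier R" and N: "submodule N R M"
  shows "submodule ((\<lambda>x. r \<odot>\<^bsub>M\<^esub> x) ` N) R M"
proof (intro submoduleI)
  note mem = submodule_mem_carrier[OF N]
  show "(\<lambda>x. r \<odot>\<^bsub>M\<^esub> x) ` N \<subseteq> carrier M" using r mem by auto
  show "\<zero>\<^bsub>M\<^esub> \<in> (\<lambda>x. r \<odot>\<^bsub>M\<^esub> x) ` N"
    using r zero_in_submodule[OF N] by (intro image_eqI[of _ _ "\<zero>\<^bsub>M\<^esub>"]) auto
  fix x assume "x \<in> (\<lambda>x. r \<odot>\<^bsub>M\<^esub> x) ` N"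
  then obtain n where n: "n \<in> N" "x = r \<odot>\<^bsub>M\<^esub> n" by auto
  then have "\<ominus>\<^bsub>M\<^esub> x = r \<odot>\<^bsub>M\<^esub> (\<ominus>\<^bsub>M\<^esub> n)" using r mem by (simp add: smult_r_minus)
  then show "\<ominus>\<^bsub>M\<^esub> x \<in> (\<lambda>x. r \<odot>\<^bsub>M\<^esub> x) ` N" using n submoduleE(3)[OF N] by blast
  show "a \<odot>\<^bsub>M\<^esub> x \<in> (\<lambda>x. r \<odot>\<^bsub>M\<^esub> x) ` N" if "a \<in> carrier R" for a
    using n that r mem smult_commute[of a r n] submoduleE(4)[OF N] by auto
  show "x \<oplus>\<^bsub>M\<^esub> y \<in> (\<lambda>x. r \<odot>\<^bsub>M\<^esub> x) ` N" if y: "y \<in> (\<lambda>x. r \<odot>\<^bsub>M\<^esub> x) ` N" for y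
  proof -
    obtain k where k: "k \<in> N" "y = r \<odot>\<^bsub>M\<^esub> k" using y by auto
    then have "x \<oplus>\<^bsub>M\<^esub> y = r \<odot>\<^bsub>M\<^esub> (n \<oplus>\<^bsub>M\<^esub> k)" using r mem n by (simp add: smult_r_distr)
    then show ?thesis using n k submoduleE(5)[OF N] by blast
  qed
qed

lemma submodule_kernel:
  assumes r: "r \<in> carrier R" and N: "submodule N R M"
  shows "submodule {x \<in> N. r \<odot>\<^bsub>M\<^esub> x = \<zero>\<^bsub>M\<^esub>} R M"
proof (intro submoduleI)
  note mem = submodule_mem_carrier[OF N]
  show "a \<odot>\<^bsub>M\<^esub> x \<in> {x \<in> N. r \<odot>\<^bsub>M\<^esub> x = \<zero>\<^bsub>M\<^esub>}"
    if "a \<in> carrier R" "x \<in> {x \<in> N. r \<odot>\<^bsub>M\<^esub> x = \<zero>\<^bsub>M\<^esub>}" for a x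
    using that mem smult_commute[OF r, of a x] submoduleE(4)[OF N] by simp
qed (use r submodule_mem_carrier[OF N] submoduleE(3,5)[OF N] zero_in_submodule[OF N] in
    \<open>auto simp: smult_r_minus smult_r_distr\<close>)

lemma submodule_cyclic:
  assumes x: "x \<in> carrier M"
  shows "submodule ((\<lambda>r. r \<odot>\<^bsub>M\<^esub> x) ` carrier R) R M"
proof (intro submoduleI)
  show "\<zero>\<^bsub>M\<^esub> \<in> (\<lambda>r. r \<odot>\<^bsub>M\<^esub> x) ` carrier R"
    using x by (intro image_eqI[of _ _ "\<zero>"]) auto
  fix y assume "y \<in> (\<lambda>r. r \<odot>\<^bsub>M\<^esub> x) ` carrier R"
  then obtain r where r: "r \<in> carrier R" "y = r \<odot>\<^bsub>M\<^esub> x" by auto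
  then have "\<ominus>\<^bsub>M\<^esub> y = (\<ominus> r) \<odot>\<^bsub>M\<^esub> x" using x by (simp add: smult_l_minus)
  then show "\<ominus>\<^bsub>M\<^esub> y \<in> (\<lambda>r. r \<odot>\<^bsub>M\<^esub> x) ` carrier R" using r by blast
  show "a \<odot>\<^bsub>M\<^esub> y \<in> (\<lambda>r. r \<odot>\<^bsub>M\<^esub> x) ` carrier R" if "a \<in> carrier R" for a
    using r x that smult_assoc1[of a r x] by (metis R.m_closed image_eqI)
  show "y \<oplus>\<^bsub>M\<^esub> z \<in> (\<lambda>r. r \<odot>\<^bsub>M\<^esub> x) ` carrier R"
    if z: "z \<in> (\<lambda>r. r \<odot>\<^bsub>M\<^esub> x) ` carrier R" for z
  proof -
    obtain t where "t \<in> carrier R" "z = t \<odot>\<^bsub>M\<^esub> x" using z by auto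
    then show ?thesis using r x smult_l_distr[of r t x] by (metis R.a_closed image_eqI)
  qed
qed (use x in auto)

lemma mem_cyclic: "x \<in> carrier M \<Longrightarrow> x \<in> (\<lambda>r. r \<odot>\<^bsub>M\<^esub> x) ` carrier R"
  by (metis R.one_closed image_eqI smult_one)

lemma cyclic_subset:
  "submodule N R M \<Longrightarrow> x \<in> N \<Longrightarrow> (\<lambda>r. r \<odot>\<^bsub>M\<^esub> x) ` carrier R \<subseteq> N"
  using submoduleE(4) by blast

definition minimal_submodule :: "'c set \<Rightarrow> bool" where
  "minimal_submodule N \<longleftrightarrow> submodule N R M \<and> N \<noteq> {\<zero>\<^bsub>M\<^esub>} \<and>
     (\<forall>L. submodule L R M \<and> L \<subseteq> N \<and> L \<noteq> {\<zero>\<^bsub>M\<^esub>} \<longrightarrow> L = N)"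

lemma minimal_Int_cases:
  assumes "minimal_submodule N" "submodule K R M"
  shows "N \<inter> K = {\<zero>\<^bsub>M\<^esub>} \<or> N \<subseteq> K"
  using assms submodule_Int unfolding minimal_submodule_def by blast

text \<open>
Schur's lemma for the multiplication by one scalar.
\<close>

lemma minimal_smult:
  assumes min: "minimal_submodule N" and r: "r \<in> carrier R" and x: "x \<in> N" "r \<odot>\<^bsub>M\<^esub> x \<noteq> \<zero>\<^bsub>M\<^esub>"
  shows "(\<lambda>x. r \<odot>\<^bsub>M\<^esub> x) ` N = N" "\<And>y. y \<in> N \<Longrightarrow> r \<odot>\<^bsub>M\<^esub> y = \<zero>\<^bsub>M\<^esub> \<Longrightarrow> y = \<zero>\<^bsub>M\<^esub>"
proof -
  have N: "submodule N R M" using min by (simp add: minimal_submodule_def)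
  show "(\<lambda>x. r \<odot>\<^bsub>M\<^esub> x) ` N = N"
    using min submodule_smult_image[OF r N] submoduleE(4)[OF N r] x
    unfolding minimal_submodule_def by (metis image_eqI image_subsetI singletonD)
  have "{y \<in> N. r \<odot>\<^bsub>M\<^esub> y = \<zero>\<^bsub>M\<^esub>} = {\<zero>\<^bsub>M\<^esub>}"
    using min submodule_kernel[OF r N] x unfolding minimal_submodule_def by blast
  then show "\<And>y. y \<in> N \<Longrightarrow> r \<odot>\<^bsub>M\<^esub> y = \<zero>\<^bsub>M\<^esub> \<Longrightarrow> y = \<zero>\<^bsub>M\<^esub>" by blast
qed

lemma minimal_cyclic:
  assumes min: "minimal_submodule N" and x: "x \<in> N" "x \<noteq> \<zero>\<^bsub>M\<^esub>"
  shows "(\<lambda>r. r \<odot>\<^bsub>M\<^esub> x) ` carrier R = N"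
proof -
  have N: "submodule N R M" using min by (simp add: minimal_submodule_def)
  then have "x \<in> carrier M" using x submodule_mem_carrier by blast
  then show ?thesis
    using min submodule_cyclic mem_cyclic cyclic_subset[OF N x(1)] x(2)
    unfolding minimal_submodule_def by (metis singletonD)
qed

text \<open>
A minimal submodule is a simple module over \<open>R\<close>, hence \<open>R\<close> acts on it through a field: a scalar that
does not kill it is invertible on it. It suffices to invert on one nonzero vector, because that
vector generates \<open>N\<close>.
\<close>

lemma minimal_multiple_identity:
  assumes min: "minimal_submodule N" and r: "r \<in> carrier R" and x: "x \<in> N" "r \<odot>\<^bsub>M\<^esub> x \<noteq> \<zero>\<^bsub>M\<^esub>"
  obtains t where "t \<in> carrier R" "\<And>y. y \<in> N \<Longrightarrow> (t \<otimes> r) \<odot>\<^bsub>M\<^esub> y = y"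
proof -
  have N: "submodule N R M" using min by (simp add: minimal_submodule_def)
  then have xM: "x \<in> carrier M" using x submodule_mem_carrier by blast
  obtain t where t: "t \<in> carrier R" "x = t \<odot>\<^bsub>M\<^esub> (r \<odot>\<^bsub>M\<^esub> x)"
    using minimal_cyclic[OF min, of "r \<odot>\<^bsub>M\<^esub> x"] x submoduleE(4)[OF N r] by blast
  have "(t \<otimes> r) \<odot>\<^bsub>M\<^esub> y = y" if y: "y \<in> N" for y
  proof -
    have "x \<noteq> \<zero>\<^bsub>M\<^esub>" using x r by auto
    then obtain u where u: "u \<in> carrier R" "y = u \<odot>\<^bsub>M\<^esub> x"
      using minimal_cyclic[OF min x(1)] y by blast
    then have "(t \<otimes> r) \<odot>\<^bsub>M\<^esub> y = u \<odot>\<^bsub>M\<^esub> ((t \<otimes> r) \<odot>\<^bsub>M\<^esub> x)"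
      using smult_commute[of "t \<otimes> r" u x] t r xM by simp
    also have "(t \<otimes> r) \<odot>\<^bsub>M\<^esub> x = x" using t r xM by (simp add: smult_assoc1)
    finally show ?thesis using u by simp
  qed
  then show ?thesis using that t by blast
qed

text \<open>
Elementwise form of \<open>NK = 0\<close>; the equivalence is \<open>submodule_prod_zero_iff\<close>. It avoids the sums in
the generated ideal product and in the generated submodule.
\<close>

definition zero_prod :: "'c set \<Rightarrow> 'c set \<Rightarrow> bool" where
  "zero_prod N K \<longleftrightarrow> (\<forall>i \<in> colon R M N. \<forall>j \<in> colon R M K. \<forall>m \<in> carrier M.
     i \<odot>\<^bsub>M\<^esub> (j \<odot>\<^bsub>M\<^esub> m) = \<zero>\<^bsub>M\<^esub>)"

lemma colonD:
  assumes "r \<in> colon R M N"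
  shows "r \<in> carrier R" "m \<in> carrier M \<Longrightarrow> r \<odot>\<^bsub>M\<^esub> m \<in> N"
  using assms by (auto simp: colon_def)

lemma zero_in_colon: "submodule N R M \<Longrightarrow> \<zero> \<in> colon R M N"
  by (auto simp: colon_def zero_in_submodule)

lemma submodule_prod_zero_iff:
  assumes N: "submodule N R M" and K: "submodule K R M"
  shows "submodule_prod R M N K = {\<zero>\<^bsub>M\<^esub>} \<longleftrightarrow> zero_prod N K"
proof
  let ?IJ = "ideal_prod R (colon R M N) (colon R M K)"
  assume *: "submodule_prod R M N K = {\<zero>\<^bsub>M\<^esub>}"
  show "zero_prod N K"
    unfolding zero_prod_def
  proof (intro ballI)
    fix i j m assume ij: "i \<in> colon R M N" "j \<in> colon R M K" and m: "m \<in> carrier M"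
    then have "(i \<otimes> j) \<odot>\<^bsub>M\<^esub> m \<in> ideal_smult M ?IJ"
      by (intro ideal_smult.smult ideal_prod.prod)
    then show "i \<odot>\<^bsub>M\<^esub> (j \<odot>\<^bsub>M\<^esub> m) = \<zero>\<^bsub>M\<^esub>"
      using * ij m colonD(1) by (auto simp: submodule_prod_def smult_assoc1)
  qed
next
  let ?IJ = "ideal_prod R (colon R M N) (colon R M K)"
  assume *: "zero_prod N K"
  have kills: "a \<in> carrier R \<and> (\<forall>m \<in> carrier M. a \<odot>\<^bsub>M\<^esub> m = \<zero>\<^bsub>M\<^esub>)" if "a \<in> ?IJ" for a
    using that
  proof induction
    case (prod i j)
    then show ?case using * colonD(1) by (auto simp: zero_prod_def smult_assoc1)
  next
    case (sum a b)
    then show ?case by (auto simp: smult_l_distr)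
  qed
  have "x = \<zero>\<^bsub>M\<^esub>" if "x \<in> ideal_smult M ?IJ" for x
    using that by induction (use kills in auto)
  \<comment> \<open>The generated sets have no base case for zero: both must be shown to be nonempty.\<close>
  moreover have "\<zero> \<otimes> \<zero> \<in> ?IJ" using N K by (intro ideal_prod.prod zero_in_colon)
  then have "(\<zero> \<otimes> \<zero>) \<odot>\<^bsub>M\<^esub> \<zero>\<^bsub>M\<^esub> \<in> ideal_smult M ?IJ"
    by (rule ideal_smult.smult) simp
  then have "\<zero>\<^bsub>M\<^esub> \<in> ideal_smult M ?IJ" by simp
  ultimately show "submodule_prod R M N K = {\<zero>\<^bsub>M\<^esub>}"
    unfolding submodule_prod_def by blast
qed

lemma zero_prod_commute: "zero_prod N K \<Longrightarrow> zero_prod K N"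
  unfolding zero_prod_def
proof (intro ballI)
  fix i j m assume zero: "\<forall>i\<in>colon R M N. \<forall>j\<in>colon R M K. \<forall>m\<in>carrier M. i \<odot>\<^bsub>M\<^esub> (j \<odot>\<^bsub>M\<^esub> m) = \<zero>\<^bsub>M\<^esub>"
    and ij: "i \<in> colon R M K" "j \<in> colon R M N" and m: "m \<in> carrier M"
  show "i \<odot>\<^bsub>M\<^esub> (j \<odot>\<^bsub>M\<^esub> m) = \<zero>\<^bsub>M\<^esub>"
    using smult_commute[OF colonD(1)[OF ij(1)] colonD(1)[OF ij(2)] m] zero ij m by simp
qed

lemma colon_mono: "N \<subseteq> K \<Longrightarrow> colon R M N \<subseteq> colon R M K"
  by (auto simp: colon_def)

lemma zero_prod_mono: "zero_prod N K \<Longrightarrow> L \<subseteq> N \<Longrightarrow> zero_prod L K"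
  using colon_mono unfolding zero_prod_def by blast

lemma zero_prod_if_disjoint:
  assumes N: "submodule N R M" and K: "submodule K R M" and "N \<inter> K = {\<zero>\<^bsub>M\<^esub>}"
  shows "zero_prod N K"
  unfolding zero_prod_def
proof (intro ballI)
  fix i j m assume ij: "i \<in> colon R M N" "j \<in> colon R M K" and m: "m \<in> carrier M"
  then have "i \<odot>\<^bsub>M\<^esub> (j \<odot>\<^bsub>M\<^esub> m) \<in> N \<inter> K"
    using colonD submoduleE(4)[OF K] by auto
  then show "i \<odot>\<^bsub>M\<^esub> (j \<odot>\<^bsub>M\<^esub> m) = \<zero>\<^bsub>M\<^esub>" using assms by blast
qed

lemma nontrivialD:
  assumes "nontrivial N"
  shows "submodule N R M" "N \<noteq> {\<zero>\<^bsub>M\<^esub>}" "N \<noteq> carrier M"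
  using assms by (auto simp: nontrivial_submodule_def)

lemma nontrivial_subset:
  assumes "submodule L R M" "L \<noteq> {\<zero>\<^bsub>M\<^esub>}" "L \<subseteq> K" "nontrivial K"
  shows "nontrivial L"
  using assms submoduleE(1) unfolding nontrivial_submodule_def by blast

lemma AG_edgeI:
  assumes "N \<in> vertices (AG R M)" "K \<in> vertices (AG R M)" "N \<noteq> K" "zero_prod N K"
  shows "{N, K} \<in> edges (AG R M)"
proof -
  have "submodule N R M" "submodule K R M" using assms by (auto simp: AG_def AG_vertices_def)
  then have "submodule_prod R M N K = {\<zero>\<^bsub>M\<^esub>}" using submodule_prod_zero_iff assms(4) by simp
  then show ?thesis using assms unfolding AG_def by fastforce
qed

lemma AG_vertex_if_zero_prod:
  assumes N: "nontrivial N" and K: "nontrivial K" and "zero_prod N K"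
  shows "N \<in> vertices (AG R M)" "K \<in> vertices (AG R M)"
proof -
  have "submodule_prod R M N K = {\<zero>\<^bsub>M\<^esub>}" "submodule_prod R M K N = {\<zero>\<^bsub>M\<^esub>}"
    using submodule_prod_zero_iff nontrivialD(1) assms zero_prod_commute by auto
  then show "N \<in> vertices (AG R M)" "K \<in> vertices (AG R M)"
    using N K nontrivialD unfolding AG_def AG_vertices_def by auto
qed

lemma AG_edge_if_zero_prod:
  assumes "nontrivial N" "nontrivial K" "zero_prod N K" "N \<noteq> K"
  shows "{N, K} \<in> edges (AG R M)"
  using assms AG_vertex_if_zero_prod[OF assms(1-3)] by (intro AG_edgeI)

lemma AG_edgeD:
  assumes "{N, K} \<in> edges (AG R M)"
  shows "zero_prod N K" "N \<in> vertices (AG R M)" "K \<in> vertices (AG R M)"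
proof -
  obtain N' K' where *: "{N, K} = {N', K'}" "N' \<in> AG_vertices R M" "K' \<in> AG_vertices R M"
    "submodule_prod R M N' K' = {\<zero>\<^bsub>M\<^esub>}" using assms by (auto simp: AG_def)
  then have "zero_prod N' K'" using submodule_prod_zero_iff by (auto simp: AG_vertices_def)
  then show "zero_prod N K" using * zero_prod_commute by (metis doubleton_eq_iff)
  show "N \<in> vertices (AG R M)" "K \<in> vertices (AG R M)" using * by (auto simp: AG_def doubleton_eq_iff)
qed

lemma simple_edges_AG: "simple_edges (AG R M)"
  unfolding simple_edges_def AG_def by simp blast

end

section \<open>Acyclicity of the graph and the inner vertices of a path\<close>

context module
begin

lemma universal_vertex_adjacent:
  assumes "\<And>i m. i \<in> colon R M K \<Longrightarrow> m \<in> carrier M \<Longrightarrow> i \<odot>\<^bsub>M\<^esub> m = \<zero>\<^bsub>M\<^esub>"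
  shows "zero_prod K N"
  using assms colonD smult_closed unfolding zero_prod_def by blast

text \<open>
A path without chords in \<open>AG(M)\<close> whose vertices are proper submodules. It need not contain all
vertices of the graph.
\<close>

definition induced_path :: "'c set \<Rightarrow> 'c set \<Rightarrow> 'c set \<Rightarrow> 'c set \<Rightarrow> bool" where
  "induced_path a b c d \<longleftrightarrow> nontrivial a \<and> nontrivial b \<and> nontrivial c \<and> nontrivial d \<and>
     distinct [a, b, c, d] \<and> zero_prod a b \<and> zero_prod b c \<and> zero_prod c d \<and>
     \<not> zero_prod a c \<and> \<not> zero_prod b d \<and> \<not> zero_prod a d"

text \<open>
Internal form of \<open>M = F \<times> S\<close>, where \<open>b\<close> corresponds to the simple module \<open>F\<close> and \<open>K\<close> to \<open>S\<close> with
its unique nontrivial submodule \<open>c\<close>.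
\<close>

definition splitting :: "'c set \<Rightarrow> 'c set \<Rightarrow> 'c set \<Rightarrow> bool" where
  "splitting b c K \<longleftrightarrow> minimal_submodule b \<and> submodule K R M \<and> b \<inter> K = {\<zero>\<^bsub>M\<^esub>} \<and>
     b <+>\<^bsub>M\<^esub> K = carrier M \<and> submodule c R M \<and> c \<noteq> {\<zero>\<^bsub>M\<^esub>} \<and> c \<noteq> K \<and> c \<subseteq> K \<and>
     (\<forall>L. submodule L R M \<and> L \<subseteq> K \<longrightarrow> L = {\<zero>\<^bsub>M\<^esub>} \<or> L = c \<or> L = K)"

lemma induced_path_rev: "induced_path a b c d \<Longrightarrow> induced_path d c b a"
  unfolding induced_path_def using zero_prod_commute by auto

lemma zero_prodD:
  assumes "zero_prod N K" "i \<in> colon R M N" "j \<in> colon R M K" "m \<in> carrier M"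
  shows "i \<odot>\<^bsub>M\<^esub> (j \<odot>\<^bsub>M\<^esub> m) = \<zero>\<^bsub>M\<^esub>"
  using assms by (auto simp: zero_prod_def)

text \<open>
This replaces \<open>N = (N : M) M\<close> by an equation with a single scalar: the product with one element
of \<open>(N : M)\<close> that does not kill \<open>M\<close> is already a nonzero submodule of the minimal \<open>N\<close>.
\<close>

lemma minimal_eq_multiple:
  assumes min: "minimal_submodule N" and r: "r \<in> colon R M N"
    and m: "m \<in> carrier M" "r \<odot>\<^bsub>M\<^esub> m \<noteq> \<zero>\<^bsub>M\<^esub>"
  shows "(\<lambda>x. r \<odot>\<^bsub>M\<^esub> x) ` carrier M = N"
proof -
  have "submodule ((\<lambda>x. r \<odot>\<^bsub>M\<^esub> x) ` carrier M) R M"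
    using submodule_smult_image carrier_is_submodule colonD(1)[OF r] by blast
  moreover have "(\<lambda>x. r \<odot>\<^bsub>M\<^esub> x) ` carrier M \<subseteq> N" using colonD(2)[OF r] by blast
  moreover have "r \<odot>\<^bsub>M\<^esub> m \<in> (\<lambda>x. r \<odot>\<^bsub>M\<^esub> x) ` carrier M" using m by blast
  then have "(\<lambda>x. r \<odot>\<^bsub>M\<^esub> x) ` carrier M \<noteq> {\<zero>\<^bsub>M\<^esub>}" using m by force
  ultimately show ?thesis using min by (auto simp: minimal_submodule_def)
qed

text \<open>
A nonzero square provides \<open>x \<in> (b : M)\<close> that does not kill \<open>b\<close>. It maps \<open>M\<close> into \<open>b\<close> and \<open>b\<close>
bijectively onto itself, so its kernel is a complement of \<open>b\<close>.
\<close>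

lemma square_nonzero_complement:
  assumes min: "minimal_submodule b" and sq: "\<not> zero_prod b b"
  obtains x where "x \<in> colon R M b"
    "b \<inter> {m \<in> carrier M. x \<odot>\<^bsub>M\<^esub> m = \<zero>\<^bsub>M\<^esub>} = {\<zero>\<^bsub>M\<^esub>}"
    "b <+>\<^bsub>M\<^esub> {m \<in> carrier M. x \<odot>\<^bsub>M\<^esub> m = \<zero>\<^bsub>M\<^esub>} = carrier M"
proof -
  have b: "submodule b R M" using min by (simp add: minimal_submodule_def)
  obtain x j m where x: "x \<in> colon R M b" and j: "j \<in> colon R M b" and m: "m \<in> carrier M"
    and ne: "x \<odot>\<^bsub>M\<^esub> (j \<odot>\<^bsub>M\<^esub> m) \<noteq> \<zero>\<^bsub>M\<^esub>"
    using sq unfolding zero_prod_def by blast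
  note xR = colonD(1)[OF x]
  have jm: "j \<odot>\<^bsub>M\<^esub> m \<in> b" using colonD(2)[OF j m] .
  note img = minimal_smult(1)[OF min xR jm ne] and inj = minimal_smult(2)[OF min xR jm ne]
  let ?K = "{m \<in> carrier M. x \<odot>\<^bsub>M\<^esub> m = \<zero>\<^bsub>M\<^esub>}"
  have K: "submodule ?K R M" using submodule_kernel[OF xR carrier_is_submodule] .
  have "b \<inter> ?K = {\<zero>\<^bsub>M\<^esub>}"
    using inj zero_in_submodule[OF b] zero_in_submodule[OF K] by blast
  moreover have "carrier M \<subseteq> b <+>\<^bsub>M\<^esub> ?K"
  proof
    fix n assume n: "n \<in> carrier M"
    then have "x \<odot>\<^bsub>M\<^esub> n \<in> (\<lambda>y. x \<odot>\<^bsub>M\<^esub> y) ` b" using colonD(2)[OF x] img by simp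
    then obtain y where y: "y \<in> b" "x \<odot>\<^bsub>M\<^esub> n = x \<odot>\<^bsub>M\<^esub> y" by blast
    note yM = submodule_mem_carrier[OF b y(1)]
    have "x \<odot>\<^bsub>M\<^esub> (n \<ominus>\<^bsub>M\<^esub> y) = \<zero>\<^bsub>M\<^esub>"
      using smult_minus_distr[OF xR n yM] y(2) xR yM by (simp add: M.minus_eq M.r_neg)
    then have "n \<ominus>\<^bsub>M\<^esub> y \<in> ?K" using n yM by simp
    moreover have "n = y \<oplus>\<^bsub>M\<^esub> (n \<ominus>\<^bsub>M\<^esub> y)" using add_minus_cancel n yM by simp
    ultimately show "n \<in> b <+>\<^bsub>M\<^esub> ?K" using y(1) set_add_iff by blast
  qed
  then have "b <+>\<^bsub>M\<^esub> ?K = carrier M"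
    using submoduleE(1)[OF submodule_set_add[OF b K]] by blast
  ultimately show ?thesis using that x by blast
qed

end

locale tree_AG_module = module R M for R (structure) and M (structure) +
  assumes tree_AG: "is_tree (AG R M)"
begin

lemma no_zero_triangle:
  assumes "nontrivial A" "nontrivial B" "nontrivial C"
    and "zero_prod A B" "zero_prod B C" "zero_prod C A"
    and "A \<noteq> B" "B \<noteq> C" "C \<noteq> A"
  shows False
  using tree_no_triangle[OF tree_AG, of A B C] AG_edge_if_zero_prod AG_vertex_if_zero_prod assms
  by auto

lemma no_zero_square:
  assumes "nontrivial A" "nontrivial B" "nontrivial C" "nontrivial D"
    and "zero_prod A B" "zero_prod B C" "zero_prod C D" "zero_prod D A" "distinct [A, B, C, D]"
  shows False
  using tree_no_square[OF tree_AG, of A B C D] AG_edge_if_zero_prod AG_vertex_if_zero_prod assms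
  by auto

text \<open>
If \<open>(K : M)\<close> kills \<open>M\<close>, then \<open>K\<close> is adjacent to every other vertex. It lies on at most one of the two
disjoint edges and forms a triangle with the other one.
\<close>

lemma no_universal:
  assumes path: "distinct [a, b, c, d]" "{a, b} \<in> edges (AG R M)" "{c, d} \<in> edges (AG R M)"
    and K: "nontrivial K"
  shows "\<exists>i \<in> colon R M K. \<exists>m \<in> carrier M. i \<odot>\<^bsub>M\<^esub> m \<noteq> \<zero>\<^bsub>M\<^esub>"
proof (rule ccontr)
  assume "\<not> ?thesis"
  then have univ: "zero_prod K N" for N
    by (intro universal_vertex_adjacent) blast
  have K_vertex: "K \<in> vertices (AG R M)"
    using AG_vertex_if_zero_prod(1)[OF K K univ] .
  have edge: "{K, N} \<in> edges (AG R M)" if "N \<in> vertices (AG R M)" "N \<noteq> K" for N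
    using AG_edgeI[OF K_vertex that(1)] that(2) univ by metis
  have False if uv: "{u, v} \<in> edges (AG R M)" "u \<noteq> v" "u \<noteq> K" "v \<noteq> K" for u v
    using tree_no_triangle[OF tree_AG, of K u v] edge[of u] edge[of v] K_vertex
      AG_edgeD(2,3)[OF uv(1)] uv by (simp add: insert_commute)
  then show False using path by (metis distinct_length_2_or_more)
qed

text \<open>
Since \<open>(M : M) = R\<close>, the equation \<open>MK = 0\<close> says that \<open>(K : M)\<close> kills \<open>M\<close>, which is excluded by
\<open>no_universal\<close>.
\<close>

lemma carrier_not_vertex:
  assumes path: "distinct [a, b, c, d]" "{a, b} \<in> edges (AG R M)" "{c, d} \<in> edges (AG R M)"
  shows "carrier M \<notin> vertices (AG R M)"
proof
  assume "carrier M \<in> vertices (AG R M)"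
  then obtain K where K: "nontrivial K" "submodule_prod R M (carrier M) K = {\<zero>\<^bsub>M\<^esub>}"
    by (auto simp: AG_def AG_vertices_def)
  then have "zero_prod (carrier M) K"
    using submodule_prod_zero_iff carrier_is_submodule nontrivialD(1) by blast
  moreover have "\<one> \<in> colon R M (carrier M)" by (simp add: colon_def)
  ultimately have "\<one> \<odot>\<^bsub>M\<^esub> (j \<odot>\<^bsub>M\<^esub> m) = \<zero>\<^bsub>M\<^esub>" if "j \<in> colon R M K" "m \<in> carrier M" for j m
    using that zero_prodD by blast
  then have "j \<odot>\<^bsub>M\<^esub> m = \<zero>\<^bsub>M\<^esub>" if "j \<in> colon R M K" "m \<in> carrier M" for j m
    using that colonD(1) by fastforce
  then show False using no_universal[OF path K(1)] by blast
qed

lemma vertex_nontrivial: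
  assumes "distinct [a, b, c, d]" "{a, b} \<in> edges (AG R M)" "{c, d} \<in> edges (AG R M)"
    and "N \<in> vertices (AG R M)"
  shows "nontrivial N"
  using carrier_not_vertex[OF assms(1-3)] assms(4)
  by (auto simp: AG_def AG_vertices_def nontrivial_submodule_def)

lemma induced_path_if_four_path:
  assumes "distinct [a, b, c, d]" "{a, b} \<in> edges (AG R M)" "{b, c} \<in> edges (AG R M)"
    "{c, d} \<in> edges (AG R M)"
  shows "induced_path a b c d"
proof -
  note nt = vertex_nontrivial[OF assms(1,2,4)]
  have "nontrivial a" "nontrivial b" "nontrivial c" "nontrivial d"
    using nt AG_edgeD(2,3)[OF assms(2)] AG_edgeD(2,3)[OF assms(4)] by auto
  note nt = this
  have p: "zero_prod a b" "zero_prod b c" "zero_prod c d" using AG_edgeD(1) assms by auto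
  have "\<not> zero_prod a c"
    using no_zero_triangle[OF nt(1-3) p(1,2)] zero_prod_commute assms(1) by auto
  moreover have "\<not> zero_prod b d"
    using no_zero_triangle[OF nt(2-4) p(2,3)] zero_prod_commute assms(1) by auto
  moreover have "\<not> zero_prod a d"
    using no_zero_square[OF nt p] zero_prod_commute assms(1) by auto
  ultimately show ?thesis using nt p assms(1) by (simp add: induced_path_def)
qed

lemma induced_path_edges:
  assumes "induced_path a b c d"
  shows "distinct [a, b, c, d]" "{a, b} \<in> edges (AG R M)" "{c, d} \<in> edges (AG R M)"
  using assms AG_edge_if_zero_prod by (auto simp: induced_path_def)

text \<open>
The intersection has zero product with \<open>a\<close>, \<open>b\<close>, \<open>c\<close> and \<open>d\<close> because it lies in both \<open>b\<close> and \<open>c\<close>. If it is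
nonzero, then it differs from \<open>b\<close>, which is not adjacent to \<open>d\<close>, and from \<open>c\<close>, which is not
adjacent to \<open>a\<close>, and it forms a triangle with them.
\<close>

lemma inner_Int:
  assumes p: "induced_path a b c d"
  shows "b \<inter> c = {\<zero>\<^bsub>M\<^esub>}"
proof (rule ccontr)
  assume ne: "b \<inter> c \<noteq> {\<zero>\<^bsub>M\<^esub>}"
  note P = p[unfolded induced_path_def]
  have nt: "nontrivial (b \<inter> c)"
    using P ne submodule_Int nontrivialD(1) nontrivial_subset[of "b \<inter> c" b] by auto
  have z: "zero_prod (b \<inter> c) a" "zero_prod (b \<inter> c) c" "zero_prod (b \<inter> c) b" "zero_prod (b \<inter> c) d"
    using P zero_prod_commute
    by (auto intro: zero_prod_mono[of b] zero_prod_mono[of c])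
  have "b \<inter> c \<noteq> b" "b \<inter> c \<noteq> c" using z P zero_prod_commute by metis+
  then show False
    using no_zero_triangle[of "b \<inter> c" b c] nt z P zero_prod_commute[of "b \<inter> c" c] by auto
qed

text \<open>
A smaller nonzero submodule has the neighbours \<open>a\<close> and \<open>c\<close> of \<open>b\<close>, which gives a square.
\<close>

lemma inner_minimal:
  assumes p: "induced_path a b c d"
  shows "minimal_submodule b"
  unfolding minimal_submodule_def
proof (intro conjI allI impI)
  note P = p[unfolded induced_path_def]
  show b: "submodule b R M" "b \<noteq> {\<zero>\<^bsub>M\<^esub>}" using P nontrivialD by auto
  fix L assume L: "submodule L R M \<and> L \<subseteq> b \<and> L \<noteq> {\<zero>\<^bsub>M\<^esub>}"
  show "L = b"
  proof (rule ccontr)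
    assume ne: "L \<noteq> b"
    have nt: "nontrivial L" using L P nontrivial_subset by blast
    have z: "zero_prod L a" "zero_prod L c"
      using P L zero_prod_commute zero_prod_mono by blast+
    have "L \<noteq> a" using z P by blast
    moreover have "L \<noteq> c" using inner_Int[OF p] L by auto
    ultimately show False
      using no_zero_square[of L a b c] nt z P ne zero_prod_commute by auto
  qed
qed

text \<open>
If both squares vanish, then every scalar in \<open>(b : M)\<close> or \<open>(c : M)\<close> kills \<open>b + c\<close>. So \<open>b + c\<close> is a
proper submodule and forms a triangle with \<open>b\<close> and \<open>c\<close>.
\<close>

lemma inner_square_nonzero:
  assumes p: "induced_path a b c d"
  shows "\<not> zero_prod b b \<or> \<not> zero_prod c c"
proof (rule ccontr)
  assume "\<not> ?thesis"
  then have sq: "zero_prod b b" "zero_prod c c" by auto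
  note P = p[unfolded induced_path_def]
  have nt: "nontrivial b" "nontrivial c" and bc: "zero_prod b c" using P by auto
  note sub = nontrivialD(1)[OF nt(1)] nontrivialD(1)[OF nt(2)]
  have min: "minimal_submodule b" "minimal_submodule c"
    using inner_minimal p induced_path_rev by blast+
  note faithful = no_universal[OF induced_path_edges[OF p]]
  obtain r m where r: "r \<in> colon R M b" and m: "m \<in> carrier M" "r \<odot>\<^bsub>M\<^esub> m \<noteq> \<zero>\<^bsub>M\<^esub>"
    using faithful[OF nt(1)] by blast
  obtain s n where s: "s \<in> colon R M c" and n: "n \<in> carrier M" "s \<odot>\<^bsub>M\<^esub> n \<noteq> \<zero>\<^bsub>M\<^esub>"
    using faithful[OF nt(2)] by blast
  have rM: "(\<lambda>x. r \<odot>\<^bsub>M\<^esub> x) ` carrier M = b" by (rule minimal_eq_multiple[OF min(1) r m])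
  have sM: "(\<lambda>x. s \<odot>\<^bsub>M\<^esub> x) ` carrier M = c" by (rule minimal_eq_multiple[OF min(2) s n])
  let ?S = "b <+>\<^bsub>M\<^esub> c"
  have kill: "j \<odot>\<^bsub>M\<^esub> x = \<zero>\<^bsub>M\<^esub>" if j: "j \<in> colon R M b \<or> j \<in> colon R M c" and x: "x \<in> ?S" for j x
  proof -
    obtain y z where yz: "y \<in> b" "z \<in> c" "x = y \<oplus>\<^bsub>M\<^esub> z" using x set_add_iff by blast
    obtain y' z' where y'z': "y' \<in> carrier M" "y = r \<odot>\<^bsub>M\<^esub> y'" "z' \<in> carrier M" "z = s \<odot>\<^bsub>M\<^esub> z'"
      using yz rM sM by blast
    then have "j \<odot>\<^bsub>M\<^esub> y = \<zero>\<^bsub>M\<^esub>" "j \<odot>\<^bsub>M\<^esub> z = \<zero>\<^bsub>M\<^esub>"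
      using j zero_prodD r s sq bc zero_prod_commute[OF bc] by metis+
    moreover have "j \<in> carrier R" using j colonD(1) by blast
    ultimately show ?thesis
      using yz submodule_mem_carrier sub by (simp add: smult_r_distr)
  qed
  have S: "submodule ?S R M" using submodule_set_add sub by blast
  have incl: "b \<subseteq> ?S" "c \<subseteq> ?S" using subset_set_add sub by auto
  \<comment> \<open>The scalar \<open>r\<close> kills \<open>b + c\<close> but not \<open>M\<close>.\<close>
  have "?S \<noteq> carrier M" using kill[of r m] r m by blast
  then have ntS: "nontrivial ?S"
    using S incl nt zero_in_submodule sub unfolding nontrivial_submodule_def by blast
  have "zero_prod b ?S" "zero_prod c ?S"
    unfolding zero_prod_def using kill colonD(2) by blast+
  moreover have "\<not> c \<subseteq> b" "\<not> b \<subseteq> c"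
    using inner_Int[OF p] nontrivialD(2)[OF nt(1)] nontrivialD(2)[OF nt(2)]
    by (metis inf.absorb_iff2) (metis inf.absorb_iff1 inner_Int[OF p] nontrivialD(2)[OF nt(1)])
  then have "?S \<noteq> b" "?S \<noteq> c" "b \<noteq> c" using incl by auto
  ultimately show False
    using no_zero_triangle[OF nt(1,2) ntS bc] zero_prod_commute by blast
qed

end

section \<open>A path on four vertices splits the module\<close>

context tree_AG_module
begin

text \<open>
Let \<open>K\<close> be the complement of \<open>b\<close>. Every nonzero submodule of \<open>K\<close> meets \<open>b\<close> in \<open>0\<close> and so is adjacent
to \<open>b\<close>; therefore none of them except \<open>c\<close> has zero product with \<open>c\<close> (the fact \<open>only_c\<close> below). The
uniqueness of \<open>c\<close> as a nontrivial submodule of \<open>K\<close> follows: a further nonzero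
submodule \<open>L\<close> contains \<open>c\<close> and a multiple \<open>eM\<close> of \<open>M\<close> by a scalar \<open>e\<close> that fixes \<open>c\<close>, and the complementary
multiple \<open>(1 - e)K\<close> has zero product with \<open>c\<close>, hence lies in \<open>c \<subseteq> L\<close>.
\<close>

lemma splitting_if_inner_square_nonzero:
  assumes p: "induced_path a b c d" and sq: "\<not> zero_prod b b"
  shows "\<exists>K. splitting b c K"
proof -
  note P = p[unfolded induced_path_def]
  have nt: "nontrivial a" "nontrivial b" "nontrivial c" "nontrivial d"
    and z: "zero_prod a b" "zero_prod b c" "zero_prod c d" "\<not> zero_prod a d" using P by auto
  note b = nontrivialD(1)[OF nt(2)] and c = nontrivialD(1)[OF nt(3)]
  have min: "minimal_submodule b" "minimal_submodule c"
    using inner_minimal p induced_path_rev by blast+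
  note faithful = no_universal[OF induced_path_edges[OF p]]
  obtain r m where r: "r \<in> colon R M b" and m: "m \<in> carrier M" "r \<odot>\<^bsub>M\<^esub> m \<noteq> \<zero>\<^bsub>M\<^esub>"
    using faithful[OF nt(2)] by blast
  obtain s n where s: "s \<in> colon R M c" and n: "n \<in> carrier M" "s \<odot>\<^bsub>M\<^esub> n \<noteq> \<zero>\<^bsub>M\<^esub>"
    using faithful[OF nt(3)] by blast
  have rM: "(\<lambda>x. r \<odot>\<^bsub>M\<^esub> x) ` carrier M = b" by (rule minimal_eq_multiple[OF min(1) r m])
  have sM: "(\<lambda>x. s \<odot>\<^bsub>M\<^esub> x) ` carrier M = c" by (rule minimal_eq_multiple[OF min(2) s n])
  obtain x where x: "x \<in> colon R M b"
    and dis: "b \<inter> {m \<in> carrier M. x \<odot>\<^bsub>M\<^esub> m = \<zero>\<^bsub>M\<^esub>} = {\<zero>\<^bsub>M\<^esub>}"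
    and sum: "b <+>\<^bsub>M\<^esub> {m \<in> carrier M. x \<odot>\<^bsub>M\<^esub> m = \<zero>\<^bsub>M\<^esub>} = carrier M"
    by (rule square_nonzero_complement[OF min(1) sq])
  define K where "K = {m \<in> carrier M. x \<odot>\<^bsub>M\<^esub> m = \<zero>\<^bsub>M\<^esub>}"
  note dis = dis[folded K_def] and sum = sum[folded K_def]
  have K: "submodule K R M"
    unfolding K_def using submodule_kernel[OF colonD(1)[OF x] carrier_is_submodule] .
  have "c \<subseteq> K"
  proof
    fix y assume y: "y \<in> c"
    then obtain y' where "y' \<in> carrier M" "y = s \<odot>\<^bsub>M\<^esub> y'" using sM by blast
    then show "y \<in> K"
      using zero_prodD[OF z(2) x s] submodule_mem_carrier[OF c y] by (simp add: K_def)
  qed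
  have "K \<noteq> carrier M" using dis nontrivialD(2)[OF nt(2)] submoduleE(1)[OF b] by blast
  moreover have "K \<noteq> {\<zero>\<^bsub>M\<^esub>}"
    using \<open>c \<subseteq> K\<close> nontrivialD(2)[OF nt(3)] zero_in_submodule[OF c] by blast
  ultimately have ntK: "nontrivial K" using K by (simp add: nontrivial_submodule_def)
  \<comment> \<open>If \<open>M = b \<oplus> c\<close>, then \<open>(d : M)\<close> kills \<open>c\<close>, so that \<open>(d : M) M = (d : M) b\<close> lies in \<open>b\<close>
    and hence is killed by \<open>(a : M)\<close>, against \<open>ad \<noteq> 0\<close>.\<close>
  have "c \<noteq> K"
  proof
    assume "c = K"
    have "zero_prod a d"
      unfolding zero_prod_def
    proof (intro ballI)
      fix i j w assume i: "i \<in> colon R M a" and j: "j \<in> colon R M d" and w: "w \<in> carrier M"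
      obtain y v where "y \<in> b" "v \<in> c" and wyv: "w = y \<oplus>\<^bsub>M\<^esub> v"
        using w sum \<open>c = K\<close> set_add_iff by blast
      then obtain y' v' where y': "y' \<in> carrier M" "y = r \<odot>\<^bsub>M\<^esub> y'"
        and v': "v' \<in> carrier M" "v = s \<odot>\<^bsub>M\<^esub> v'"
        using rM sM by blast
      note R = colonD(1)[OF i] colonD(1)[OF j] colonD(1)[OF r] colonD(1)[OF s]
      have "j \<odot>\<^bsub>M\<^esub> v = \<zero>\<^bsub>M\<^esub>"
        using zero_prodD[OF zero_prod_commute[OF z(3)] j s v'(1)] v'(2) by simp
      then have "j \<odot>\<^bsub>M\<^esub> w = j \<odot>\<^bsub>M\<^esub> y" using wyv y' v' R by (simp add: smult_r_distr)
      then have "i \<odot>\<^bsub>M\<^esub> (j \<odot>\<^bsub>M\<^esub> w) = j \<odot>\<^bsub>M\<^esub> (i \<odot>\<^bsub>M\<^esub> (r \<odot>\<^bsub>M\<^esub> y'))"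
        using smult_commute[OF R(1,2), of y] y' R by simp
      also have "\<dots> = \<zero>\<^bsub>M\<^esub>" using zero_prodD[OF z(1) i r y'(1)] R by simp
      finally show "i \<odot>\<^bsub>M\<^esub> (j \<odot>\<^bsub>M\<^esub> w) = \<zero>\<^bsub>M\<^esub>" .
    qed
    then show False using z(4) by blast
  qed
  have bL: "b \<inter> L = {\<zero>\<^bsub>M\<^esub>}" if "submodule L R M" "L \<subseteq> K" for L
    using dis that zero_in_submodule[OF b] zero_in_submodule[OF that(1)] by blast
  have bc: "b \<inter> c = {\<zero>\<^bsub>M\<^esub>}" using inner_Int[OF p] .
  have only_c: "L = {\<zero>\<^bsub>M\<^esub>} \<or> L = c" if L: "submodule L R M" "L \<subseteq> K" "zero_prod L c" for L
  proof (rule ccontr)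
    assume ne: "\<not> ?thesis"
    then have ntL: "nontrivial L" using nontrivial_subset[OF L(1) _ L(2) ntK] by blast
    moreover have "b \<noteq> L" using bL[OF L(1,2)] nontrivialD(2)[OF nt(2)] by auto
    moreover have "b \<noteq> c" using P by auto
    ultimately show False
      using no_zero_triangle[OF nt(2,3) ntL z(2) zero_prod_commute[OF L(3)]] ne
        zero_prod_if_disjoint[OF L(1) b] bL[OF L(1,2)] by (metis inf_commute)
  qed
  have "L = {\<zero>\<^bsub>M\<^esub>} \<or> L = c \<or> L = K" if L: "submodule L R M" "L \<subseteq> K" for L
  proof (rule ccontr)
    assume ne: "\<not> ?thesis"
    then have "\<not> zero_prod L c" using only_c[OF L] by blast
    then obtain i j w where i: "i \<in> colon R M L" and j: "j \<in> colon R M c" and w: "w \<in> carrier M"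
      and ijw: "i \<odot>\<^bsub>M\<^esub> (j \<odot>\<^bsub>M\<^esub> w) \<noteq> \<zero>\<^bsub>M\<^esub>" unfolding zero_prod_def by blast
    have "c \<inter> L \<noteq> {\<zero>\<^bsub>M\<^esub>}"
      using zero_prod_if_disjoint[OF L(1) c] \<open>\<not> zero_prod L c\<close> by (metis inf_commute)
    then have "c \<subseteq> L" using minimal_Int_cases[OF min(2) L(1)] by blast
    note iR = colonD(1)[OF i]
    obtain t where t: "t \<in> carrier R" and id: "\<And>y. y \<in> c \<Longrightarrow> (t \<otimes> i) \<odot>\<^bsub>M\<^esub> y = y"
      by (rule minimal_multiple_identity[OF min(2) iR colonD(2)[OF j w] ijw]) (use that in blast)
    \<comment> \<open>The scalar \<open>e\<close> maps \<open>M\<close> into \<open>L\<close> and is the identity on \<open>c\<close>.\<close>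
    define e where "e = t \<otimes> i"
    have e: "e \<in> carrier R" using t iR by (simp add: e_def)
    have eL: "e \<odot>\<^bsub>M\<^esub> m \<in> L" if "m \<in> carrier M" for m
      using that t iR colonD(2)[OF i that] submoduleE(4)[OF L(1) t] by (simp add: e_def smult_assoc1)
    let ?f = "\<one> \<ominus> e"
    have f: "?f \<in> carrier R" using e by simp
    have fc: "?f \<odot>\<^bsub>M\<^esub> y = \<zero>\<^bsub>M\<^esub>" if "y \<in> c" for y
      using smult_diff_one[OF e submodule_mem_carrier[OF c that]] id[OF that]
        submodule_mem_carrier[OF c that] by (simp add: e_def M.minus_eq M.r_neg)
    let ?fK = "(\<lambda>x. ?f \<odot>\<^bsub>M\<^esub> x) ` K"
    have fK: "submodule ?fK R M" "?fK \<subseteq> K"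
      using submodule_smult_image[OF f K] submoduleE(4)[OF K f] by auto
    have fKc: "zero_prod ?fK c"
      unfolding zero_prod_def
    proof (intro ballI)
      fix g q v assume g: "g \<in> colon R M ?fK" and q: "q \<in> colon R M c" and v: "v \<in> carrier M"
      obtain k where k: "k \<in> K" "g \<odot>\<^bsub>M\<^esub> v = ?f \<odot>\<^bsub>M\<^esub> k" using colonD(2)[OF g v] by blast
      note kM = submodule_mem_carrier[OF K k(1)] and qR = colonD(1)[OF q]
      have "g \<odot>\<^bsub>M\<^esub> (q \<odot>\<^bsub>M\<^esub> v) = ?f \<odot>\<^bsub>M\<^esub> (q \<odot>\<^bsub>M\<^esub> k)"
        using smult_commute[OF colonD(1)[OF g] qR v] smult_commute[OF qR f kM] k(2) by simp
      then show "g \<odot>\<^bsub>M\<^esub> (q \<odot>\<^bsub>M\<^esub> v) = \<zero>\<^bsub>M\<^esub>" using fc[OF colonD(2)[OF q kM]] by simp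
    qed
    have fKL: "?fK \<subseteq> L"
      using only_c[OF fK fKc]
    proof
      assume "?fK = {\<zero>\<^bsub>M\<^esub>}"
      then show ?thesis by (rule ssubst) (simp add: zero_in_submodule[OF L(1)])
    next
      assume "?fK = c"
      then show ?thesis by (rule ssubst) (rule \<open>c \<subseteq> L\<close>)
    qed
    have "k \<in> L" if k: "k \<in> K" for k
    proof -
      note kM = submodule_mem_carrier[OF K k]
      have "k = e \<odot>\<^bsub>M\<^esub> k \<oplus>\<^bsub>M\<^esub> ?f \<odot>\<^bsub>M\<^esub> k"
        using smult_diff_one[OF e kM] add_minus_cancel[OF kM, of "e \<odot>\<^bsub>M\<^esub> k"] e kM by simp
      moreover have "?f \<odot>\<^bsub>M\<^esub> k \<in> L" using fKL k by blast
      ultimately show ?thesis using submoduleE(5)[OF L(1) eL[OF kM]] by metis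
    qed
    then show False using ne L(2) by blast
  qed
  then have "splitting b c K"
    unfolding splitting_def
    using min K dis sum c nontrivialD(2)[OF nt(3)] \<open>c \<noteq> K\<close> \<open>c \<subseteq> K\<close> by blast
  then show ?thesis ..
qed

text \<open>
By \<open>inner_square_nonzero\<close> one of the two inner vertices has nonzero square. Reversing the path makes
it the second vertex.
\<close>

lemma splitting_if_four_path:
  assumes "has_four_path (AG R M)"
  shows "\<exists>b c K. splitting b c K"
proof -
  obtain a b c d where p: "induced_path a b c d"
    using assms induced_path_if_four_path unfolding has_four_path_def by blast
  then show ?thesis
    using inner_square_nonzero[OF p] splitting_if_inner_square_nonzero[OF p]
      splitting_if_inner_square_nonzero[OF induced_path_rev[OF p]] by blast
qed

end

section \<open>The graph of a split module\<close>

context module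
begin

lemma splittingD:
  assumes "splitting b c K"
  shows "minimal_submodule b" "submodule b R M" "b \<noteq> {\<zero>\<^bsub>M\<^esub>}" "submodule K R M" "b \<inter> K = {\<zero>\<^bsub>M\<^esub>}"
    "b <+>\<^bsub>M\<^esub> K = carrier M" "submodule c R M" "c \<noteq> {\<zero>\<^bsub>M\<^esub>}" "c \<noteq> K" "c \<subseteq> K"
    "\<And>L. submodule L R M \<Longrightarrow> L \<subseteq> K \<Longrightarrow> L = {\<zero>\<^bsub>M\<^esub>} \<or> L = c \<or> L = K"
  using assms unfolding splitting_def minimal_submodule_def by blast+

lemma splitting_minimal:
  assumes sp: "splitting b c K"
  shows "minimal_submodule c"
  unfolding minimal_submodule_def
proof (intro conjI allI impI)
  fix L assume L: "submodule L R M \<and> L \<subseteq> c \<and> L \<noteq> {\<zero>\<^bsub>M\<^esub>}"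
  then have "L \<subseteq> K" using splittingD(10)[OF sp] by blast
  then show "L = c" using L splittingD(9,10)[OF sp] splittingD(11)[OF sp, of L] by blast
qed (use splittingD[OF sp] in auto)

lemma splitting_generator:
  assumes sp: "splitting b c K"
  obtains k where "k \<in> K" "k \<notin> c" "(\<lambda>r. r \<odot>\<^bsub>M\<^esub> k) ` carrier R = K"
proof -
  obtain k where k: "k \<in> K" "k \<notin> c" using splittingD(9,10)[OF sp] by blast
  note kM = submodule_mem_carrier[OF splittingD(4)[OF sp] k(1)]
  have "(\<lambda>r. r \<odot>\<^bsub>M\<^esub> k) ` carrier R \<noteq> {\<zero>\<^bsub>M\<^esub>}" "(\<lambda>r. r \<odot>\<^bsub>M\<^esub> k) ` carrier R \<noteq> c"
    using mem_cyclic[OF kM] k(2) zero_in_submodule[OF splittingD(7)[OF sp]]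
    by (metis singletonD, metis)
  then have "(\<lambda>r. r \<odot>\<^bsub>M\<^esub> k) ` carrier R = K"
    using splittingD(11)[OF sp submodule_cyclic[OF kM] cyclic_subset[OF splittingD(4)[OF sp] k(1)]]
    by blast
  then show ?thesis using that k by blast
qed

text \<open>
The module \<open>K\<close> is uniserial of length two with the simple submodule \<open>c\<close>, and \<open>c\<close> is
isomorphic to \<open>K/c\<close>, so a scalar that kills \<open>K/c\<close> also kills \<open>c\<close>. Concretely: if \<open>s\<close> maps \<open>K\<close> into \<open>c\<close> without
killing \<open>c\<close>, then \<open>s\<close> maps \<open>c\<close> onto \<open>c\<close> and its kernel in \<open>K\<close> is a nonzero submodule that does not
contain \<open>c\<close>.
\<close>

lemma splitting_nilpotent:
  assumes sp: "splitting b c K" and s: "s \<in> carrier R"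
    and into: "\<And>k. k \<in> K \<Longrightarrow> s \<odot>\<^bsub>M\<^esub> k \<in> c" and y: "y \<in> c"
  shows "s \<odot>\<^bsub>M\<^esub> y = \<zero>\<^bsub>M\<^esub>"
proof (rule ccontr)
  assume ne: "s \<odot>\<^bsub>M\<^esub> y \<noteq> \<zero>\<^bsub>M\<^esub>"
  note K = splittingD(4)[OF sp] and c = splittingD(7)[OF sp]
  have sc: "(\<lambda>x. s \<odot>\<^bsub>M\<^esub> x) ` c = c"
    using minimal_smult(1)[OF splitting_minimal[OF sp] s y ne] .
  obtain k where k: "k \<in> K" "k \<notin> c" using splittingD(9,10)[OF sp] by blast
  have "s \<odot>\<^bsub>M\<^esub> k \<in> (\<lambda>x. s \<odot>\<^bsub>M\<^esub> x) ` c" using into[OF k(1)] sc by simp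
  then obtain x where x: "x \<in> c" "s \<odot>\<^bsub>M\<^esub> k = s \<odot>\<^bsub>M\<^esub> x" by blast
  note kM = submodule_mem_carrier[OF K k(1)] and xM = submodule_mem_carrier[OF c x(1)]
  have xK: "x \<in> K" using x splittingD(10)[OF sp] by blast
  let ?ker = "{x \<in> K. s \<odot>\<^bsub>M\<^esub> x = \<zero>\<^bsub>M\<^esub>}"
  have "s \<odot>\<^bsub>M\<^esub> (k \<ominus>\<^bsub>M\<^esub> x) = \<zero>\<^bsub>M\<^esub>"
    using smult_minus_distr[OF s kM xM] x(2) s xM by (simp add: M.minus_eq M.r_neg)
  then have "k \<ominus>\<^bsub>M\<^esub> x \<in> ?ker" using submodule_minus_closed[OF K k(1) xK] by simp
  moreover have "k \<ominus>\<^bsub>M\<^esub> x \<noteq> \<zero>\<^bsub>M\<^esub>"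
  proof
    assume "k \<ominus>\<^bsub>M\<^esub> x = \<zero>\<^bsub>M\<^esub>"
    then have "k = x" using add_minus_cancel[OF kM xM] xM by simp
    then show False using k(2) x(1) by simp
  qed
  ultimately have "?ker \<noteq> {\<zero>\<^bsub>M\<^esub>}" by blast
  then have "?ker = c \<or> ?ker = K"
    using splittingD(11)[OF sp submodule_kernel[OF s K]] by blast
  then show False using ne y splittingD(10)[OF sp] by blast
qed

lemma splitting_middle_proper:
  assumes sp: "splitting b c K" and k: "k \<in> K" "k \<in> b <+>\<^bsub>M\<^esub> c"
  shows "k \<in> c"
proof -
  note D = splittingD[OF sp]
  obtain y z where yz: "y \<in> b" "z \<in> c" "k = y \<oplus>\<^bsub>M\<^esub> z" using k(2) set_add_iff by blast
  note M = submodule_mem_carrier[OF D(2) yz(1)] submodule_mem_carrier[OF D(7) yz(2)]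
  have "z \<in> K" using yz(2) D(10) by blast
  then have "k \<ominus>\<^bsub>M\<^esub> z \<in> K" using submodule_minus_closed[OF D(4) k(1)] by simp
  moreover have "k \<ominus>\<^bsub>M\<^esub> z = y" using yz(3) M by (simp add: M.minus_eq M.a_assoc M.r_neg)
  ultimately have "y = \<zero>\<^bsub>M\<^esub>" using yz(1) D(5) by blast
  then show ?thesis using yz M by simp
qed

lemma splitting_nontrivial:
  assumes sp: "splitting b c K"
  shows "nontrivial b" "nontrivial c" "nontrivial K" "nontrivial (b <+>\<^bsub>M\<^esub> c)"
    "distinct [K, b, c, b <+>\<^bsub>M\<^esub> c]"
proof -
  note D = splittingD[OF sp]
  note incl = subset_set_add[OF D(2) D(7)]
  have bK: "\<not> b \<subseteq> K" using D(3,5) by blast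
  have cb: "\<not> c \<subseteq> b"
    using D(5,8,10) zero_in_submodule[OF D(7)] by blast
  obtain k where k: "k \<in> K" "k \<notin> c" using D(9,10) by blast
  then have kS: "k \<notin> b <+>\<^bsub>M\<^esub> c" using splitting_middle_proper[OF sp] by blast
  have kM: "k \<in> carrier M" using k(1) submodule_mem_carrier[OF D(4)] by blast
  have S: "submodule (b <+>\<^bsub>M\<^esub> c) R M" using submodule_set_add[OF D(2) D(7)] .
  have "b <+>\<^bsub>M\<^esub> c \<noteq> {\<zero>\<^bsub>M\<^esub>}" using incl D(3) zero_in_submodule[OF D(2)] by blast
  then show S': "nontrivial (b <+>\<^bsub>M\<^esub> c)"
    using S kS kM by (auto simp: nontrivial_submodule_def)
  show "nontrivial b" "nontrivial c"
    using nontrivial_subset[OF D(2) D(3) incl(1) S'] nontrivial_subset[OF D(7) D(8) incl(2) S'] .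
  have "K \<noteq> {\<zero>\<^bsub>M\<^esub>}" using D(8,10) zero_in_submodule[OF D(7)] by blast
  moreover have "K \<noteq> carrier M" using bK submoduleE(1)[OF D(2)] by blast
  ultimately show "nontrivial K" using D(4) by (simp add: nontrivial_submodule_def)
  have "K \<noteq> b" "K \<noteq> c" "K \<noteq> b <+>\<^bsub>M\<^esub> c" "b \<noteq> c" "b \<noteq> b <+>\<^bsub>M\<^esub> c" "c \<noteq> b <+>\<^bsub>M\<^esub> c"
    using bK cb incl D(9,10) by auto
  then show "distinct [K, b, c, b <+>\<^bsub>M\<^esub> c]" by simp
qed

text \<open>
These are the three edges of the path \<open>K - b - c - (b + c)\<close>. The first two hold because the
submodules meet in \<open>0\<close>; for the last one, a scalar in \<open>(c : M)\<close> maps \<open>b\<close> into \<open>b \<inter> c\<close> and kills \<open>c\<close> by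
\<open>splitting_nilpotent\<close>.
\<close>

lemma splitting_zero_prods:
  assumes sp: "splitting b c K"
  shows "zero_prod K b" "zero_prod b c" "zero_prod c (b <+>\<^bsub>M\<^esub> c)"
proof -
  note D = splittingD[OF sp]
  show "zero_prod K b" using zero_prod_if_disjoint[OF D(4) D(2)] D(5) by (simp add: inf_commute)
  have bc: "b \<inter> c = {\<zero>\<^bsub>M\<^esub>}" using D(5,10) zero_in_submodule[OF D(2)] zero_in_submodule[OF D(7)] by blast
  then show "zero_prod b c" using zero_prod_if_disjoint[OF D(2) D(7)] by simp
  show "zero_prod c (b <+>\<^bsub>M\<^esub> c)"
    unfolding zero_prod_def
  proof (intro ballI)
    fix i j m assume i: "i \<in> colon R M c" and j: "j \<in> colon R M (b <+>\<^bsub>M\<^esub> c)" and m: "m \<in> carrier M"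
    note iR = colonD(1)[OF i]
    obtain y z where yz: "y \<in> b" "z \<in> c" "j \<odot>\<^bsub>M\<^esub> m = y \<oplus>\<^bsub>M\<^esub> z"
      using colonD(2)[OF j m] set_add_iff by blast
    note M = submodule_mem_carrier[OF D(2) yz(1)] submodule_mem_carrier[OF D(7) yz(2)]
    have "i \<odot>\<^bsub>M\<^esub> y \<in> b \<inter> c" using colonD(2)[OF i M(1)] submoduleE(4)[OF D(2) iR yz(1)] by blast
    then have "i \<odot>\<^bsub>M\<^esub> y = \<zero>\<^bsub>M\<^esub>" using bc by blast
    moreover have "i \<odot>\<^bsub>M\<^esub> z = \<zero>\<^bsub>M\<^esub>"
      using splitting_nilpotent[OF sp iR _ yz(2)] colonD(2)[OF i] submodule_mem_carrier[OF D(4)] by blast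
    ultimately show "i \<odot>\<^bsub>M\<^esub> (j \<odot>\<^bsub>M\<^esub> m) = \<zero>\<^bsub>M\<^esub>" using yz(3) M iR by (simp add: smult_r_distr)
  qed
qed

text \<open>
Since \<open>K\<close> is cyclic, a scalar \<open>s\<close> with \<open>sK = K\<close> is invertible on \<open>K\<close>, say with \<open>us = 1\<close> there. By
assumption \<open>us = 1\<close> then also holds on \<open>b\<close>, which is impossible if \<open>s\<close> kills \<open>b\<close>. So \<open>sK\<close> is at most
\<open>c\<close> and \<open>splitting_nilpotent\<close> applies.
\<close>

lemma splitting_same_annihilator:
  assumes sp: "splitting b c K"
    and ann: "\<And>s y. s \<in> carrier R \<Longrightarrow> (\<And>k. k \<in> K \<Longrightarrow> s \<odot>\<^bsub>M\<^esub> k = \<zero>\<^bsub>M\<^esub>) \<Longrightarrow> y \<in> b \<Longrightarrow> s \<odot>\<^bsub>M\<^esub> y = \<zero>\<^bsub>M\<^esub>"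
    and s: "s \<in> carrier R" and sb: "\<And>y. y \<in> b \<Longrightarrow> s \<odot>\<^bsub>M\<^esub> y = \<zero>\<^bsub>M\<^esub>" and z: "z \<in> c"
  shows "s \<odot>\<^bsub>M\<^esub> z = \<zero>\<^bsub>M\<^esub>"
proof -
  note D = splittingD[OF sp]
  let ?sK = "(\<lambda>x. s \<odot>\<^bsub>M\<^esub> x) ` K"
  have "?sK = {\<zero>\<^bsub>M\<^esub>} \<or> ?sK = c \<or> ?sK = K"
    using D(11)[OF submodule_smult_image[OF s D(4)]] submoduleE(4)[OF D(4) s] by blast
  moreover have "?sK \<noteq> K"
  proof
    assume surj: "?sK = K"
    obtain k where k: "k \<in> K" "k \<notin> c" and gen: "(\<lambda>r. r \<odot>\<^bsub>M\<^esub> k) ` carrier R = K"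
      by (rule splitting_generator[OF sp]) (use that in blast)
    note kM = submodule_mem_carrier[OF D(4) k(1)]
    obtain l where l: "l \<in> K" "k = s \<odot>\<^bsub>M\<^esub> l" using surj k by blast
    obtain u where u: "u \<in> carrier R" "l = u \<odot>\<^bsub>M\<^esub> k" using gen l(1) by blast
    define f where "f = \<one> \<ominus> u \<otimes> s"
    have f: "f \<in> carrier R" using u s by (simp add: f_def)
    have fx: "f \<odot>\<^bsub>M\<^esub> x = x \<ominus>\<^bsub>M\<^esub> u \<odot>\<^bsub>M\<^esub> (s \<odot>\<^bsub>M\<^esub> x)" if "x \<in> carrier M" for x
      using smult_diff_one[of "u \<otimes> s" x] that u(1) s by (simp add: f_def smult_assoc1)
    have "u \<odot>\<^bsub>M\<^esub> (s \<odot>\<^bsub>M\<^esub> k) = k"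
      unfolding smult_commute[OF u(1) s kM] u(2)[symmetric] l(2)[symmetric] ..
    then have "f \<odot>\<^bsub>M\<^esub> k = \<zero>\<^bsub>M\<^esub>" using fx[OF kM] kM by (simp add: M.minus_eq M.r_neg)
    then have "f \<odot>\<^bsub>M\<^esub> (v \<odot>\<^bsub>M\<^esub> k) = \<zero>\<^bsub>M\<^esub>" if "v \<in> carrier R" for v
      using smult_commute[OF f that kM] that by simp
    then have fK: "f \<odot>\<^bsub>M\<^esub> x = \<zero>\<^bsub>M\<^esub>" if "x \<in> K" for x
      using that unfolding gen[symmetric] by blast
    have fb: "f \<odot>\<^bsub>M\<^esub> y = \<zero>\<^bsub>M\<^esub>" if "y \<in> b" for y using ann[OF f fK that] .
    have "y = \<zero>\<^bsub>M\<^esub>" if y: "y \<in> b" for y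
    proof -
      note yM = submodule_mem_carrier[OF D(2) y]
      have "u \<odot>\<^bsub>M\<^esub> (s \<odot>\<^bsub>M\<^esub> y) = \<zero>\<^bsub>M\<^esub>" using sb[OF y] u(1) by simp
      then show ?thesis using add_minus_cancel[OF yM, of "\<zero>\<^bsub>M\<^esub>"] fx[OF yM] fb[OF y] by simp
    qed
    then show False using D(3) zero_in_submodule[OF D(2)] by blast
  qed
  ultimately have "?sK \<subseteq> c" using zero_in_submodule[OF D(7)]
    by (metis empty_subsetI insert_subset order_refl)
  then show ?thesis using splitting_nilpotent[OF sp s _ z] by blast
qed

text \<open>
A scalar that kills \<open>K\<close> but not \<open>b\<close> has a multiple that acts as the projection of \<open>b \<oplus> K\<close> onto \<open>b\<close>.
Every submodule is closed under this projection and so is the direct sum of its intersections with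
\<open>b\<close> and \<open>K\<close>; there are two possibilities for the first and three for the second.
\<close>

lemma splitting_submodules:
  assumes sp: "splitting b c K"
    and s: "s \<in> carrier R" "\<And>k. k \<in> K \<Longrightarrow> s \<odot>\<^bsub>M\<^esub> k = \<zero>\<^bsub>M\<^esub>" and v: "v \<in> b" "s \<odot>\<^bsub>M\<^esub> v \<noteq> \<zero>\<^bsub>M\<^esub>"
    and N: "nontrivial N"
  shows "N \<in> {K, b, c, b <+>\<^bsub>M\<^esub> c}"
proof -
  note D = splittingD[OF sp] and NM = nontrivialD[OF N]
  obtain t where t: "t \<in> carrier R" and id: "\<And>y. y \<in> b \<Longrightarrow> (t \<otimes> s) \<odot>\<^bsub>M\<^esub> y = y"
    by (rule minimal_multiple_identity[OF D(1) s(1) v]) (use that in blast)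
  have comp: "y \<in> N \<and> k \<in> N" if y: "y \<in> b" and k: "k \<in> K" and n: "y \<oplus>\<^bsub>M\<^esub> k \<in> N" for y k
  proof -
    note M = submodule_mem_carrier[OF D(2) y] submodule_mem_carrier[OF D(4) k]
    have "(t \<otimes> s) \<odot>\<^bsub>M\<^esub> (y \<oplus>\<^bsub>M\<^esub> k) = (t \<otimes> s) \<odot>\<^bsub>M\<^esub> y \<oplus>\<^bsub>M\<^esub> (t \<otimes> s) \<odot>\<^bsub>M\<^esub> k"
      using t s(1) M by (intro smult_r_distr) auto
    also have "\<dots> = y" using id[OF y] M t s(1) s(2)[OF k] by (simp add: smult_assoc1)
    finally have yN: "y \<in> N" using submoduleE(4)[OF NM(1) _ n, of "t \<otimes> s"] t s(1) by simp
    have "(y \<oplus>\<^bsub>M\<^esub> k) \<ominus>\<^bsub>M\<^esub> y = k" using M by (simp add: M.minus_eq M.a_comm[of y k] M.a_assoc M.r_neg)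
    then show ?thesis using yN submodule_minus_closed[OF NM(1) n yN] by simp
  qed
  have split: "\<exists>y k. y \<in> b \<and> y \<in> N \<and> k \<in> K \<and> k \<in> N \<and> n = y \<oplus>\<^bsub>M\<^esub> k" if n: "n \<in> N" for n
  proof -
    have "n \<in> b <+>\<^bsub>M\<^esub> K" using submodule_mem_carrier[OF NM(1) n] D(6) by simp
    then obtain y k where "y \<in> b" "k \<in> K" "n = y \<oplus>\<^bsub>M\<^esub> k" using set_add_iff by blast
    then show ?thesis using comp n by blast
  qed
  show ?thesis
  proof (cases "b \<inter> N = {\<zero>\<^bsub>M\<^esub>}")
    case True
    have "N \<subseteq> K"
    proof
      fix n assume "n \<in> N"
      then obtain y k where yk: "y \<in> b" "y \<in> N" "k \<in> K" "n = y \<oplus>\<^bsub>M\<^esub> k" using split by blast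
      then have "y = \<zero>\<^bsub>M\<^esub>" using True by blast
      then show "n \<in> K" using yk submodule_mem_carrier[OF D(4) yk(3)] by simp
    qed
    then show ?thesis using D(11)[OF NM(1)] NM(2) by blast
  next
    case False
    then have bN: "b \<subseteq> N" using minimal_Int_cases[OF D(1) NM(1)] by blast
    have sub: "N \<subseteq> b <+>\<^bsub>M\<^esub> (N \<inter> K)" using split set_add_iff by blast
    have sup: "b <+>\<^bsub>M\<^esub> (N \<inter> K) \<subseteq> N"
    proof
      fix n assume "n \<in> b <+>\<^bsub>M\<^esub> (N \<inter> K)"
      then obtain y k where yk: "y \<in> b" "k \<in> N" "n = y \<oplus>\<^bsub>M\<^esub> k"
        unfolding set_add_iff by blast
      show "n \<in> N" using submoduleE(5)[OF NM(1) subsetD[OF bN yk(1)] yk(2)] yk(3) by simp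
    qed
    have eq: "N = b <+>\<^bsub>M\<^esub> (N \<inter> K)" using sub sup by blast
    have "b <+>\<^bsub>M\<^esub> {\<zero>\<^bsub>M\<^esub>} = b"
      using submodule_mem_carrier[OF D(2)] by (force simp: set_add_def')
    moreover have "N \<inter> K = {\<zero>\<^bsub>M\<^esub>} \<or> N \<inter> K = c \<or> N \<inter> K = K"
      using D(11)[OF submodule_Int[OF NM(1) D(4)]] by blast
    ultimately show ?thesis using eq D(6) NM(3) by (metis insert_iff)
  qed
qed

end

context tree_AG_module
begin

text \<open>
This is where acyclicity excludes that \<open>b\<close> is isomorphic to the top \<open>K/c\<close> of \<open>K\<close>. If no such scalar
exists, then \<open>(K : M)\<close>, which kills \<open>b\<close>, also kills \<open>c\<close> by \<open>splitting_same_annihilator\<close>, and \<open>c\<close>,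
\<open>b + c\<close> and \<open>K\<close> form a triangle.
\<close>

lemma splitting_separating_scalar:
  assumes sp: "splitting b c K"
  obtains s v where "s \<in> carrier R" "\<And>k. k \<in> K \<Longrightarrow> s \<odot>\<^bsub>M\<^esub> k = \<zero>\<^bsub>M\<^esub>" "v \<in> b" "s \<odot>\<^bsub>M\<^esub> v \<noteq> \<zero>\<^bsub>M\<^esub>"
proof (rule ccontr)
  assume "\<not> thesis"
  then have ann: "\<And>s y. s \<in> carrier R \<Longrightarrow> (\<And>k. k \<in> K \<Longrightarrow> s \<odot>\<^bsub>M\<^esub> k = \<zero>\<^bsub>M\<^esub>) \<Longrightarrow> y \<in> b \<Longrightarrow> s \<odot>\<^bsub>M\<^esub> y = \<zero>\<^bsub>M\<^esub>"
    using that by blast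
  note D = splittingD[OF sp] and nt = splitting_nontrivial[OF sp]
  have kill_b: "j \<odot>\<^bsub>M\<^esub> y = \<zero>\<^bsub>M\<^esub>" if j: "j \<in> colon R M K" and y: "y \<in> b" for j y
  proof -
    have "j \<odot>\<^bsub>M\<^esub> y \<in> b \<inter> K"
      using colonD(2)[OF j submodule_mem_carrier[OF D(2) y]] submoduleE(4)[OF D(2) colonD(1)[OF j] y]
      by blast
    then show ?thesis using D(5) by blast
  qed
  have kill_c: "j \<odot>\<^bsub>M\<^esub> z = \<zero>\<^bsub>M\<^esub>" if j: "j \<in> colon R M K" and z: "z \<in> c" for j z
    using splitting_same_annihilator[OF sp ann colonD(1)[OF j] kill_b[OF j] z] by blast
  have "zero_prod K (b <+>\<^bsub>M\<^esub> c)"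
    unfolding zero_prod_def
  proof (intro ballI)
    fix i j m assume i: "i \<in> colon R M K" and j: "j \<in> colon R M (b <+>\<^bsub>M\<^esub> c)" and m: "m \<in> carrier M"
    obtain y z where yz: "y \<in> b" "z \<in> c" "j \<odot>\<^bsub>M\<^esub> m = y \<oplus>\<^bsub>M\<^esub> z"
      using colonD(2)[OF j m] set_add_iff by blast
    then show "i \<odot>\<^bsub>M\<^esub> (j \<odot>\<^bsub>M\<^esub> m) = \<zero>\<^bsub>M\<^esub>"
      using kill_b[OF i yz(1)] kill_c[OF i yz(2)] colonD(1)[OF i]
        submodule_mem_carrier[OF D(2) yz(1)] submodule_mem_carrier[OF D(7) yz(2)]
      by (simp add: smult_r_distr)
  qed
  moreover have "zero_prod K c"
    unfolding zero_prod_def using kill_c colonD(2) by blast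
  ultimately show False
    using no_zero_triangle[OF nt(3,4,2)] zero_prod_commute splitting_zero_prods(3)[OF sp] nt(5)
    by auto
qed

lemma splitting_imp_iso_path:
  assumes sp: "splitting b c K"
  shows "graph_iso (AG R M) (path_graph 4)"
proof -
  note nt = splitting_nontrivial[OF sp] and zp = splitting_zero_prods[OF sp]
  have E: "{K, b} \<in> edges (AG R M)" "{b, c} \<in> edges (AG R M)" "{c, b <+>\<^bsub>M\<^esub> c} \<in> edges (AG R M)"
    using AG_edge_if_zero_prod nt zp by auto
  obtain s v where s: "s \<in> carrier R" "\<And>k. k \<in> K \<Longrightarrow> s \<odot>\<^bsub>M\<^esub> k = \<zero>\<^bsub>M\<^esub>" "v \<in> b" "s \<odot>\<^bsub>M\<^esub> v \<noteq> \<zero>\<^bsub>M\<^esub>"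
    by (rule splitting_separating_scalar[OF sp]) (use that in blast)
  have "vertices (AG R M) \<subseteq> {K, b, c, b <+>\<^bsub>M\<^esub> c}"
    using splitting_submodules[OF sp s] vertex_nontrivial[OF nt(5) E(1,3)] by (meson subsetI)
  then have "vertices (AG R M) = {K, b, c, b <+>\<^bsub>M\<^esub> c}"
    using AG_edgeD(2,3)[OF E(1)] AG_edgeD(2,3)[OF E(3)] by blast
  then show ?thesis
    using iso_path_if_spanning_four_path[OF tree_AG simple_edges_AG _ nt(5) E] by blast
qed

end

section \<open>Internal and external decompositions\<close>

text \<open>
Free of the additive inverse, whose value in a module on a restricted carrier is not syntactically
the one in the ambient module.
\<close>

lemma (in module) submodule_iff:
  "submodule H R M \<longleftrightarrow> H \<subseteq> carrier M \<and> \<zero>\<^bsub>M\<^esub> \<in> H \<and>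
     (\<forall>x \<in> H. \<forall>y \<in> H. x \<oplus>\<^bsub>M\<^esub> y \<in> H) \<and> (\<forall>a \<in> carrier R. \<forall>x \<in> H. a \<odot>\<^bsub>M\<^esub> x \<in> H)"
proof (intro iffI submoduleI)
  assume "submodule H R M"
  then show "H \<subseteq> carrier M \<and> \<zero>\<^bsub>M\<^esub> \<in> H \<and>
     (\<forall>x \<in> H. \<forall>y \<in> H. x \<oplus>\<^bsub>M\<^esub> y \<in> H) \<and> (\<forall>a \<in> carrier R. \<forall>x \<in> H. a \<odot>\<^bsub>M\<^esub> x \<in> H)"
    using submoduleE[of H] zero_in_submodule by auto
next
  assume *: "H \<subseteq> carrier M \<and> \<zero>\<^bsub>M\<^esub> \<in> H \<and>
     (\<forall>x \<in> H. \<forall>y \<in> H. x \<oplus>\<^bsub>M\<^esub> y \<in> H) \<and> (\<forall>a \<in> carrier R. \<forall>x \<in> H. a \<odot>\<^bsub>M\<^esub> x \<in> H)"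
  show "\<ominus>\<^bsub>M\<^esub> x \<in> H" if "x \<in> H" for x
  proof -
    have "(\<ominus> \<one>) \<odot>\<^bsub>M\<^esub> x \<in> H" using * that by simp
    moreover have "x \<in> carrier M" using * that by blast
    ultimately show ?thesis by (simp add: smult_l_minus)
  qed
qed blast+

text \<open>
Truncating the record extension makes the type independent of the scheme of \<open>M\<close>, so that a submodule
is an object of the type over which the decomposition is quantified.
\<close>

definition module_on :: "('a, 'b, 'd) module_scheme \<Rightarrow> 'b set \<Rightarrow> ('a, 'b) module" where
  "module_on M H = module.truncate (M\<lparr>carrier := H\<rparr>)"

lemma module_on_simps [simp]:
  "carrier (module_on M H) = H" "\<zero>\<^bsub>module_on M H\<^esub> = \<zero>\<^bsub>M\<^esub>"
  "x \<oplus>\<^bsub>module_on M H\<^esub> y = x \<oplus>\<^bsub>M\<^esub> y" "r \<odot>\<^bsub>module_on M H\<^esub> x = r \<odot>\<^bsub>M\<^esub> x"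
  by (simp_all add: module_on_def module.defs)

lemma (in module) module_on_submodule:
  assumes H: "submodule H R M"
  shows "module R (module_on M H)"
proof -
  note S = H[unfolded submodule_iff]
  have mem: "x \<in> carrier M" if "x \<in> H" for x using S that by blast
  have "cring R" ..
  moreover have "abelian_group (module_on M H)"
  proof (rule abelian_groupI)
    fix x assume x: "x \<in> carrier (module_on M H)"
    then have "\<ominus>\<^bsub>M\<^esub> x \<in> H" using submoduleE(3)[OF H] by simp
    then show "\<exists>y\<in>carrier (module_on M H). y \<oplus>\<^bsub>module_on M H\<^esub> x = \<zero>\<^bsub>module_on M H\<^esub>"
      using x mem by (auto intro!: bexI[of _ "\<ominus>\<^bsub>M\<^esub> x"] simp: M.l_neg)
  qed (use S mem in \<open>auto simp: M.a_ac\<close>)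
  ultimately show ?thesis
    using S mem by (intro moduleI) (auto simp: smult_l_distr smult_r_distr smult_assoc1)
qed

lemma (in module) submodule_module_on_iff:
  assumes H: "submodule H R M"
  shows "submodule L R (module_on M H) \<longleftrightarrow> submodule L R M \<and> L \<subseteq> H"
proof -
  interpret H: module R "module_on M H" by (rule module_on_submodule[OF H])
  show ?thesis
    using submoduleE(1)[OF H] unfolding H.submodule_iff submodule_iff by auto
qed

lemma module_prod_simps:
  "carrier (module_prod F S) = carrier F \<times> carrier S"
  "(u, v) \<oplus>\<^bsub>module_prod F S\<^esub> (u', v') = (u \<oplus>\<^bsub>F\<^esub> u', v \<oplus>\<^bsub>S\<^esub> v')"
  "r \<odot>\<^bsub>module_prod F S\<^esub> (u, v) = (r \<odot>\<^bsub>F\<^esub> u, r \<odot>\<^bsub>S\<^esub> v)"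
  by (simp_all add: module_prod_def RDirProd_def DirProd_def ring.defs monoid.defs)

text \<open>
The isomorphism is the inverse of the addition \<open>b \<times> K \<rightarrow> M\<close>.
\<close>

lemma (in module) module_iso_internal_sum:
  assumes b: "submodule b R M" and K: "submodule K R M"
    and dis: "b \<inter> K = {\<zero>\<^bsub>M\<^esub>}" and sum: "b <+>\<^bsub>M\<^esub> K = carrier M"
  shows "module_iso R M (module_prod (module_on M b) (module_on M K))"
proof -
  note mem = submodule_mem_carrier[OF b] submodule_mem_carrier[OF K]
  define g where "g = (\<lambda>(u, v). u \<oplus>\<^bsub>M\<^esub> v)"
  have "inj_on g (b \<times> K)"
  proof (rule inj_onI, clarsimp simp: g_def)
    fix u v u' v' assume uv: "u \<in> b" "v \<in> K" "u' \<in> b" "v' \<in> K" and eq: "u \<oplus>\<^bsub>M\<^esub> v = u' \<oplus>\<^bsub>M\<^esub> v'"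
    note M = mem(1)[OF uv(1)] mem(2)[OF uv(2)] mem(1)[OF uv(3)] mem(2)[OF uv(4)]
    have "u \<ominus>\<^bsub>M\<^esub> u' = (u \<oplus>\<^bsub>M\<^esub> v) \<ominus>\<^bsub>M\<^esub> v \<ominus>\<^bsub>M\<^esub> u'"
      using M by (simp add: M.minus_eq M.a_assoc M.r_neg)
    also have "\<dots> = (v' \<ominus>\<^bsub>M\<^esub> v) \<oplus>\<^bsub>M\<^esub> (u' \<oplus>\<^bsub>M\<^esub> \<ominus>\<^bsub>M\<^esub> u')"
      unfolding eq M.minus_eq using M by (simp only: M.a_ac M.a_closed M.a_inv_closed)
    also have "\<dots> = v' \<ominus>\<^bsub>M\<^esub> v" using M by (simp add: M.r_neg)
    finally have "u \<ominus>\<^bsub>M\<^esub> u' \<in> b \<inter> K"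
      using submodule_minus_closed[OF b uv(1,3)] submodule_minus_closed[OF K uv(4,2)] by simp
    then have "u \<ominus>\<^bsub>M\<^esub> u' = \<zero>\<^bsub>M\<^esub>" using dis by blast
    then have "u = u'" using add_minus_cancel[OF M(1,3)] M by simp
    then show "u = u' \<and> v = v'" using eq M by simp
  qed
  moreover have "g ` (b \<times> K) = carrier M"
    unfolding sum[symmetric] set_add_def' g_def image_def by simp blast
  ultimately have bij: "bij_betw g (b \<times> K) (carrier M)" by (simp add: bij_betw_def)
  define h where "h = the_inv_into (b \<times> K) g"
  have h_g: "h (g p) = p" if "p \<in> b \<times> K" for p
    using the_inv_into_f_f that bij unfolding h_def bij_betw_def by metis
  have g_h: "\<exists>u v. u \<in> b \<and> v \<in> K \<and> x = g (u, v)" if "x \<in> carrier M" for x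
    using that bij unfolding bij_betw_def by blast
  have add: "h (x \<oplus>\<^bsub>M\<^esub> y) = h x \<oplus>\<^bsub>module_prod (module_on M b) (module_on M K)\<^esub> h y"
    if xy: "x \<in> carrier M" "y \<in> carrier M" for x y
  proof -
    obtain u v where uv: "u \<in> b" "v \<in> K" "x = g (u, v)" using g_h xy(1) by blast
    obtain u' v' where u'v': "u' \<in> b" "v' \<in> K" "y = g (u', v')" using g_h xy(2) by blast
    have "x \<oplus>\<^bsub>M\<^esub> y = g (u \<oplus>\<^bsub>M\<^esub> u', v \<oplus>\<^bsub>M\<^esub> v')"
      using uv u'v' mem by (simp add: g_def M.a_ac)
    moreover have "u \<oplus>\<^bsub>M\<^esub> u' \<in> b" "v \<oplus>\<^bsub>M\<^esub> v' \<in> K"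
      using uv u'v' submoduleE(5)[OF b] submoduleE(5)[OF K] by auto
    ultimately show ?thesis using h_g uv u'v' by (simp add: module_prod_simps)
  qed
  have smult: "h (r \<odot>\<^bsub>M\<^esub> x) = r \<odot>\<^bsub>module_prod (module_on M b) (module_on M K)\<^esub> h x"
    if r: "r \<in> carrier R" and x: "x \<in> carrier M" for r x
  proof -
    obtain u v where uv: "u \<in> b" "v \<in> K" "x = g (u, v)" using g_h x by blast
    have "r \<odot>\<^bsub>M\<^esub> x = g (r \<odot>\<^bsub>M\<^esub> u, r \<odot>\<^bsub>M\<^esub> v)"
      using uv mem r by (simp add: g_def smult_r_distr)
    moreover have "r \<odot>\<^bsub>M\<^esub> u \<in> b" "r \<odot>\<^bsub>M\<^esub> v \<in> K"
      using uv submoduleE(4)[OF b r] submoduleE(4)[OF K r] by auto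
    ultimately show ?thesis using h_g uv by (simp add: module_prod_simps)
  qed
  have "bij_betw h (carrier M) (b \<times> K)"
    unfolding h_def using bij by (rule bij_betw_the_inv_into)
  then show ?thesis
    unfolding module_iso_def using add smult
    by (intro exI[of _ h]) (simp add: module_prod_simps)
qed

lemma (in module) product_if_splitting:
  assumes sp: "splitting b c K"
  shows "\<exists>(F :: ('a, 'c) module) (S :: ('a, 'c) module). simple_module R F \<and> module R S \<and>
    (\<exists>!T. nontrivial_submodule T R S) \<and> module_iso R M (module_prod F S)"
proof (intro exI conjI)
  note D = splittingD[OF sp]
  have "\<not> nontrivial_submodule L R (module_on M b)" for L
    using D(1) by (auto simp: nontrivial_submodule_def submodule_module_on_iff[OF D(2)] minimal_submodule_def)
  then show "simple_module R (module_on M b)"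
    using module_on_submodule[OF D(2)] D(3) by (simp add: simple_module_def)
  show "module R (module_on M K)" by (rule module_on_submodule[OF D(4)])
  show "\<exists>!T. nontrivial_submodule T R (module_on M K)"
    unfolding nontrivial_submodule_def submodule_module_on_iff[OF D(4)]
    using D(7-11) by (intro ex1I[of _ c]) auto
  show "module_iso R M (module_prod (module_on M b) (module_on M K))"
    by (rule module_iso_internal_sum[OF D(2,4,5,6)])
qed

locale linear_map = dom: module R M + cod: module R N
  for R (structure) and M (structure) and N (structure) and f +
  assumes closed: "x \<in> carrier M \<Longrightarrow> f x \<in> carrier N"
    and add: "x \<in> carrier M \<Longrightarrow> y \<in> carrier M \<Longrightarrow> f (x \<oplus>\<^bsub>M\<^esub> y) = f x \<oplus>\<^bsub>N\<^esub> f y"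
    and smult: "a \<in> carrier R \<Longrightarrow> x \<in> carrier M \<Longrightarrow> f (a \<odot>\<^bsub>M\<^esub> x) = a \<odot>\<^bsub>N\<^esub> f x"
begin

lemma zero: "f \<zero>\<^bsub>M\<^esub> = \<zero>\<^bsub>N\<^esub>"
  using smult[of "\<zero>" "\<zero>\<^bsub>M\<^esub>"] closed[of "\<zero>\<^bsub>M\<^esub>"] by simp

lemma submodule_image:
  assumes "submodule L R M"
  shows "submodule (f ` L) R N"
proof -
  have L: "L \<subseteq> carrier M" "\<zero>\<^bsub>M\<^esub> \<in> L" "\<And>x y. x \<in> L \<Longrightarrow> y \<in> L \<Longrightarrow> x \<oplus>\<^bsub>M\<^esub> y \<in> L"
    "\<And>a x. a \<in> carrier R \<Longrightarrow> x \<in> L \<Longrightarrow> a \<odot>\<^bsub>M\<^esub> x \<in> L"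
    using assms unfolding dom.submodule_iff by blast+
  have "f x \<oplus>\<^bsub>N\<^esub> f y \<in> f ` L" if "x \<in> L" "y \<in> L" for x y
    using add[of x y] L(1) L(3)[OF that] that by (metis image_eqI subsetD)
  moreover have "a \<odot>\<^bsub>N\<^esub> f x \<in> f ` L" if "a \<in> carrier R" "x \<in> L" for a x
    using smult[of a x] L(1) L(4)[OF that] that by (metis image_eqI subsetD)
  moreover have "\<zero>\<^bsub>N\<^esub> \<in> f ` L" using L(2) zero by (metis image_eqI)
  moreover have "f ` L \<subseteq> carrier N" using L(1) closed by blast
  ultimately show ?thesis unfolding cod.submodule_iff by auto
qed

lemma submodule_preimage:
  assumes "submodule T R N"
  shows "submodule {x \<in> carrier M. f x \<in> T} R M"
  using assms add smult zero unfolding cod.submodule_iff dom.submodule_iff by auto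

end

text \<open>
With \<open>f\<close> and \<open>g\<close> the two components of the isomorphism, \<open>b\<close> and \<open>K\<close> are the kernels of \<open>g\<close> and \<open>f\<close>,
and \<open>c\<close> is the preimage in \<open>K\<close> of the nontrivial submodule of \<open>S\<close>. Images and preimages of submodules
under \<open>f\<close> and \<open>g\<close> carry the submodule structure of the factors over to \<open>b\<close> and \<open>K\<close>.
\<close>

lemma (in module) splitting_if_product:
  assumes F: "simple_module R F" and S: "module R S" and uniq: "\<exists>!T. nontrivial_submodule T R S"
    and iso: "module_iso R M (module_prod F S)"
  shows "\<exists>b c K. splitting b c K"
proof -
  interpret F: module R F using F by (simp add: simple_module_def)
  interpret S: module R S by fact
  obtain h where bij: "bij_betw h (carrier M) (carrier F \<times> carrier S)"
    and h_add: "\<And>x y. x \<in> carrier M \<Longrightarrow> y \<in> carrier M \<Longrightarrow>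
      h (x \<oplus>\<^bsub>M\<^esub> y) = h x \<oplus>\<^bsub>module_prod F S\<^esub> h y"
    and h_smult: "\<And>a x. a \<in> carrier R \<Longrightarrow> x \<in> carrier M \<Longrightarrow>
      h (a \<odot>\<^bsub>M\<^esub> x) = a \<odot>\<^bsub>module_prod F S\<^esub> h x"
    using iso unfolding module_iso_def module_prod_simps by blast
  define f where "f x = fst (h x)" for x
  define g where "g x = snd (h x)" for x
  have h: "h x = (f x, g x)" for x by (simp add: f_def g_def)
  have mem: "f x \<in> carrier F" "g x \<in> carrier S" if "x \<in> carrier M" for x
    using bij that by (auto simp: bij_betw_def h)
  interpret f: linear_map R M F f
    by unfold_locales (use mem h_add h_smult in \<open>simp_all add: h module_prod_simps\<close>)
  interpret g: linear_map R M S g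
    by unfold_locales (use mem h_add h_smult in \<open>simp_all add: h module_prod_simps\<close>)
  have eqI: "x = y" if "x \<in> carrier M" "y \<in> carrier M" "f x = f y" "g x = g y" for x y
    using bij that unfolding bij_betw_def inj_on_def h by blast
  have ex: "\<exists>x \<in> carrier M. f x = u \<and> g x = v" if "u \<in> carrier F" "v \<in> carrier S" for u v
  proof -
    have "(u, v) \<in> h ` carrier M" using bij that by (simp add: bij_betw_def)
    then show ?thesis by (auto simp: h)
  qed
  obtain T where T: "nontrivial_submodule T R S" using uniq by blast
  have T_sub: "submodule T R S" and T_ne: "T \<noteq> {\<zero>\<^bsub>S\<^esub>}" "T \<noteq> carrier S"
    using T by (auto simp: nontrivial_submodule_def)
  have T_cases: "L = {\<zero>\<^bsub>S\<^esub>} \<or> L = T \<or> L = carrier S" if "submodule L R S" for L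
    using that T uniq by (auto simp: nontrivial_submodule_def)
  have F_cases: "L = {\<zero>\<^bsub>F\<^esub>} \<or> L = carrier F" if "submodule L R F" for L
    using that F by (auto simp: simple_module_def nontrivial_submodule_def)
  define b where "b = {x \<in> carrier M. g x \<in> {\<zero>\<^bsub>S\<^esub>}}"
  define K where "K = {x \<in> carrier M. f x \<in> {\<zero>\<^bsub>F\<^esub>}}"
  define c where "c = {x \<in> carrier M. g x \<in> T} \<inter> K"
  have b: "submodule b R M" unfolding b_def by (rule g.submodule_preimage[OF S.zero_submodule])
  have K: "submodule K R M" unfolding K_def by (rule f.submodule_preimage[OF F.zero_submodule])
  have c: "submodule c R M"
    unfolding c_def by (rule submodule_Int[OF g.submodule_preimage[OF T_sub] K])
  have zeroI: "x = \<zero>\<^bsub>M\<^esub>" if "x \<in> carrier M" "f x = \<zero>\<^bsub>F\<^esub>" "g x = \<zero>\<^bsub>S\<^esub>" for x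
    using eqI[of x "\<zero>\<^bsub>M\<^esub>"] that f.zero g.zero by simp
  have K_image: "L = {x \<in> K. g x \<in> g ` L}" if L: "L \<subseteq> K" for L
  proof (intro equalityI subsetI)
    fix x assume "x \<in> {x \<in> K. g x \<in> g ` L}"
    then obtain y where xy: "x \<in> K" "y \<in> L" "g x = g y" by blast
    then have "y \<in> K" using L by blast
    then have "x = y" using xy(1,3) by (intro eqI) (simp_all add: K_def)
    then show "x \<in> L" using xy(2) by simp
  qed (use L in blast)
  have "minimal_submodule b"
    unfolding minimal_submodule_def
  proof (intro conjI allI impI)
    obtain u where u: "u \<in> carrier F" "u \<noteq> \<zero>\<^bsub>F\<^esub>"
      using F F.zero_closed by (auto simp: simple_module_def)
    then obtain x where "x \<in> carrier M" "f x = u" "g x = \<zero>\<^bsub>S\<^esub>"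
      using ex[OF u(1) S.zero_closed] by blast
    then have "x \<in> b" "x \<noteq> \<zero>\<^bsub>M\<^esub>" using u f.zero by (auto simp: b_def)
    then show "b \<noteq> {\<zero>\<^bsub>M\<^esub>}" by blast
    fix L assume "submodule L R M \<and> L \<subseteq> b \<and> L \<noteq> {\<zero>\<^bsub>M\<^esub>}"
    then have L: "submodule L R M" "L \<subseteq> b" "L \<noteq> {\<zero>\<^bsub>M\<^esub>}" by auto
    obtain x where x: "x \<in> L" "x \<noteq> \<zero>\<^bsub>M\<^esub>" using L(3) zero_in_submodule[OF L(1)] by blast
    then have "f x \<noteq> \<zero>\<^bsub>F\<^esub>" using zeroI[of x] L(2) by (auto simp: b_def)
    then have "f ` L \<noteq> {\<zero>\<^bsub>F\<^esub>}" using x(1) by blast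
    then have fL: "f ` L = carrier F" using F_cases[OF f.submodule_image[OF L(1)]] by blast
    have "y \<in> L" if y: "y \<in> b" for y
    proof -
      have "f y \<in> f ` L" using y mem fL by (simp add: b_def)
      then obtain z where z: "z \<in> L" "f y = f z" by blast
      then have "y = z" using eqI[of y z] y L(2) by (auto simp: b_def)
      then show ?thesis using z by simp
    qed
    then show "L = b" using L(2) by blast
  qed (rule b)
  moreover have "b \<inter> K = {\<zero>\<^bsub>M\<^esub>}"
    using zeroI zero_in_submodule[OF b] zero_in_submodule[OF K] by (auto simp: b_def K_def)
  moreover have "x \<in> b <+>\<^bsub>M\<^esub> K" if x: "x \<in> carrier M" for x
  proof -
    obtain y where y: "y \<in> carrier M" "f y = f x" "g y = \<zero>\<^bsub>S\<^esub>"
      using ex[OF mem(1)[OF x] S.zero_closed] by blast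
    obtain z where z: "z \<in> carrier M" "f z = \<zero>\<^bsub>F\<^esub>" "g z = g x"
      using ex[OF F.zero_closed mem(2)[OF x]] by blast
    have "x = y \<oplus>\<^bsub>M\<^esub> z" using x y z mem by (intro eqI) (simp_all add: f.add g.add)
    then show ?thesis using y z by (auto simp: set_add_iff b_def K_def)
  qed
  then have "b <+>\<^bsub>M\<^esub> K = carrier M" using submoduleE(1)[OF submodule_set_add[OF b K]] by blast
  moreover have "c \<noteq> {\<zero>\<^bsub>M\<^esub>}"
  proof -
    obtain t where t: "t \<in> T" "t \<noteq> \<zero>\<^bsub>S\<^esub>" using T_ne S.zero_in_submodule[OF T_sub] by blast
    then obtain x where "x \<in> carrier M" "f x = \<zero>\<^bsub>F\<^esub>" "g x = t"
      using ex[OF F.zero_closed S.submodule_mem_carrier[OF T_sub t(1)]] by blast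
    then have "x \<in> c" "x \<noteq> \<zero>\<^bsub>M\<^esub>" using t g.zero by (auto simp: c_def K_def)
    then show ?thesis by blast
  qed
  moreover have "c \<noteq> K"
  proof -
    obtain t where t: "t \<in> carrier S" "t \<notin> T" using T_ne S.submodule_mem_carrier[OF T_sub] by blast
    then obtain x where "x \<in> carrier M" "f x = \<zero>\<^bsub>F\<^esub>" "g x = t"
      using ex[OF F.zero_closed t(1)] by blast
    then have "x \<in> K" "x \<notin> c" using t by (auto simp: c_def K_def)
    then show ?thesis by blast
  qed
  moreover have "L = {\<zero>\<^bsub>M\<^esub>} \<or> L = c \<or> L = K" if L: "submodule L R M" "L \<subseteq> K" for L
  proof -
    have "{x \<in> K. g x \<in> {\<zero>\<^bsub>S\<^esub>}} = {\<zero>\<^bsub>M\<^esub>}"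
      using zeroI f.zero g.zero by (auto simp: K_def)
    moreover have "{x \<in> K. g x \<in> T} = c" by (auto simp: c_def K_def)
    moreover have "{x \<in> K. g x \<in> carrier S} = K" using mem by (auto simp: K_def)
    ultimately show ?thesis
      using T_cases[OF g.submodule_image[OF L(1)]] K_image[OF L(2)] by metis
  qed
  moreover have "c \<subseteq> K" by (simp add: c_def)
  ultimately have "splitting b c K" unfolding splitting_def using K c by blast
  then show ?thesis by blast
qed

theorem theorem2p7:
  fixes R :: "('a, 'c) ring_scheme" and M :: "('a, 'b, 'd) module_scheme"
  assumes "cring R" and "\<one>\<^bsub>R\<^esub> \<noteq> \<zero>\<^bsub>R\<^esub>"
    and "module R M"
    and "is_tree (AG R M)"
  shows "(is_star (AG R M) \<or> graph_iso (AG R M) (path_graph 4)) \<and>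
    (graph_iso (AG R M) (path_graph 4) \<longleftrightarrow>
      (\<exists>(F :: ('a, 'b) module) (S :: ('a, 'b) module).
         simple_module R F \<and>
         module R S \<and> (\<exists>!T. nontrivial_submodule T R S) \<and>
         module_iso R M (module_prod F S)))"
proof -
  interpret tree_AG_module R M
    using assms(3,4) by (simp add: tree_AG_module_def tree_AG_module_axioms_def)
  have path: "graph_iso (AG R M) (path_graph 4) \<longleftrightarrow> (\<exists>b c K. splitting b c K)"
    using splitting_imp_iso_path splitting_if_four_path four_path_if_iso by blast
  have "is_star (AG R M) \<or> graph_iso (AG R M) (path_graph 4)"
    using tree_star_or_four_path[OF tree_AG simple_edges_AG] splitting_if_four_path path by metis
  moreover have "(\<exists>b c K. splitting b c K) \<longleftrightarrow>
      (\<exists>(F :: ('a, 'b) module) (S :: ('a, 'b) module). simple_module R F \<and>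
         module R S \<and> (\<exists>!T. nontrivial_submodule T R S) \<and> module_iso R M (module_prod F S))"
    (is "_ \<longleftrightarrow> ?product")
  proof
    assume "\<exists>b c K. splitting b c K"
    then show ?product by (elim exE) (rule product_if_splitting)
  next
    assume ?product
    then show "\<exists>b c K. splitting b c K" by (elim exE conjE) (rule splitting_if_product)
  qed
  ultimately show ?thesis unfolding path by (rule conjI)
qed

end
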